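(* Let $G$ be a bounded domain in $\mathbb{C}^n$ ($n\ge 2$). Assume that $D\Subset G$ is a $\mathcal{C}^2$-smooth domain in $\mathbb{C}^n$ whose Levi form has at least one positive eigenvalue at each boundary point. Then $G\setminus\overline{D}$ is a domain such that $k_{G\setminus\overline{D}}$ is quasi-isometrically equivalent to the restriction $k_G|_{(G\setminus\overline{D})\times(G\setminus\overline{D})}$. In particular, if $G$ is Gromov $k$-hyperbolic, then so is $G\setminus\overline{D}$.
   Context: $D\Subset G$ means that $\overline{D}$ is a compact subset of $G$. The Levi form of $D$ at a boundary point $b$ is the complex Hessian at $b$ of a $\mathcal{C}^2$ defining function of $D$ (negative in $D$, with nonvanishing gradient on $\partial D$), restricted to the complex tangent space of $\partial D$ at $b$. Let $\mathbb{D}$ be the open unit disc in $\mathbb{C}$. For a domain $\Omega\subset\mathbb{C}^n$, the Lempert function is $l_\Omega(z,w)=\inf\{\tanh^{-1}|\alpha| : \exists\,\varphi:\mathbb{D}\to \Omega \text{ holomorphic with } \varphi(0)=z,\ \varphi(\alpha)=w\}$, and the Kobayashi distance $k_\Omega$ is the largest pseudodistance on $\Omega$ not exceeding $l_\Omega$. Two distances $d_1,d_2$ on a set $X$ are quasi-isometrically equivalent if there are constants $c_1,c_2>0$ such that $c_1^{-1}d_1(x,y)-c_2\le d_2(x,y)\le c_1d_1(x,y)+c_2$ for all $x,y\in X$. For a metric space $(X,d)$ and $x,y,z\in X$, the Gromov product is $(x,y)_z=d(x,z)+d(z,y)-d(x,y)$. Put $S_d(p,q,x,w)=\min\{(p,x)_w,(x,q)_w\}-(p,q)_w$.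 The space $(X,d)$ is Gromov hyperbolic if $\sup_{p,q,x,w\in X}S_d(p,q,x,w)<\infty$. A domain $\Omega$ is Gromov $k$-hyperbolic if $(\Omega,k_\Omega)$ is Gromov hyperbolic. *)

theory Defs
  imports "HOL-Complex_Analysis.Complex_Analysis"
begin

section \<open>Domains, the Lempert function and the Kobayashi distance\<close>

definition is_domain :: "'a::topological_space set \<Rightarrow> bool" where
  "is_domain \<Omega> \<longleftrightarrow> open \<Omega> \<and> connected \<Omega> \<and> \<Omega> \<noteq> {}"

definition compactly_contained :: "'a::topological_space set \<Rightarrow> 'a set \<Rightarrow> bool" where
  "compactly_contained D G \<longleftrightarrow> compact (closure D) \<and> closure D \<subseteq> G"

text \<open>
  A map into a finite-dimensional complex space is holomorphic iff all its coordinates are.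
\<close>

definition holomorphic_disc :: "(complex ^ 'n) set \<Rightarrow> (complex \<Rightarrow> complex ^ 'n) \<Rightarrow> bool" where
  "holomorphic_disc \<Omega> \<phi> \<longleftrightarrow>
     (\<forall>i. (\<lambda>\<zeta>. \<phi> \<zeta> $ i) holomorphic_on ball 0 1) \<and> \<phi> ` ball 0 1 \<subseteq> \<Omega>"

text \<open>
  The values are extended reals, so that the infimum is infinite if no disc passes through
  the two points.
\<close>

definition lempert :: "(complex ^ 'n) set \<Rightarrow> complex ^ 'n \<Rightarrow> complex ^ 'n \<Rightarrow> ereal" where
  "lempert \<Omega> z w =
     Inf {ereal (artanh (cmod \<alpha>)) | \<alpha>. \<alpha> \<in> ball 0 1 \<and>
            (\<exists>\<phi>. holomorphic_disc \<Omega> \<phi> \<and> \<phi> 0 = z \<and> \<phi> \<alpha> = w)}"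

definition pseudodistance_on :: "'a set \<Rightarrow> ('a \<Rightarrow> 'a \<Rightarrow> real) \<Rightarrow> bool" where
  "pseudodistance_on X d \<longleftrightarrow>
     (\<forall>x\<in>X. \<forall>y\<in>X. 0 \<le> d x y) \<and> (\<forall>x\<in>X. d x x = 0) \<and>
     (\<forall>x\<in>X. \<forall>y\<in>X. d x y = d y x) \<and>
     (\<forall>x\<in>X. \<forall>y\<in>X. \<forall>z\<in>X. d x z \<le> d x y + d y z)"

definition below_lempert :: "(complex ^ 'n) set \<Rightarrow> (complex ^ 'n \<Rightarrow> complex ^ 'n \<Rightarrow> real) \<Rightarrow> bool" where
  "below_lempert \<Omega> d \<longleftrightarrow>
     pseudodistance_on \<Omega> d \<and> (\<forall>z\<in>\<Omega>. \<forall>w\<in>\<Omega>. ereal (d z w) \<le> lempert \<Omega> z w)"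

text \<open>
  The largest pseudodistance below the Lempert function, as a pointwise supremum. That it is
  indeed the largest one on every domain, and a distance on every bounded domain, is
  \<open>kobayashi_below_lempert\<close>, \<open>kobayashi_greatest\<close> and \<open>kobayashi_eq_0_iff\<close> below. The values
  outside \<open>\<Omega> \<times> \<Omega>\<close> are irrelevant.
\<close>

definition kobayashi :: "(complex ^ 'n) set \<Rightarrow> complex ^ 'n \<Rightarrow> complex ^ 'n \<Rightarrow> real" where
  "kobayashi \<Omega> z w = Sup {d z w | d. below_lempert \<Omega> d}"

lemma artanh_ge_self:
  fixes x :: real
  assumes "0 \<le> x" "x < 1"
  shows "x \<le> artanh x"
proof -
  have "artanh 0 - 0 \<le> artanh x - x"
  proof (rule DERIV_nonneg_imp_nondecreasing[OF assms(1)])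
    fix t assume t: "0 \<le> t" "t \<le> x"
    then have "\<bar>t\<bar> < 1" and "t\<^sup>2 < 1"
      using assms by (auto simp: power_less_one_iff abs_square_less_1)
    then have "((\<lambda>u. artanh u - u) has_real_derivative (1 / (1 - t\<^sup>2) - 1)) (at t)"
      by (auto intro!: derivative_eq_intros)
    moreover have "0 \<le> 1 / (1 - t\<^sup>2) - 1"
      using \<open>t\<^sup>2 < 1\<close> by (simp add: field_simps)
    ultimately show "\<exists>y. ((\<lambda>u. artanh u - u) has_real_derivative y) (at t) \<and> 0 \<le> y"
      by blast
  qed
  then show ?thesis by simp
qed

lemma lempert_nonneg: "0 \<le> lempert \<Omega> z w"
  unfolding lempert_def
proof (rule Inf_greatest, clarify)
  fix \<alpha> :: complex
  assume "\<alpha> \<in> ball 0 1"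
  then show "0 \<le> ereal (artanh (cmod \<alpha>))"
    using artanh_ge_self[of "cmod \<alpha>"] norm_ge_zero[of \<alpha>]
    by (simp del: norm_ge_zero)
qed

lemma below_lempert_zero: "below_lempert \<Omega> (\<lambda>z w. 0)"
  using lempert_nonneg by (auto simp: below_lempert_def pseudodistance_on_def zero_ereal_def)

lemma lempert_ball_finite:
  fixes a w :: "complex ^ 'n"
  assumes "ball a r \<subseteq> \<Omega>" "w \<in> ball a r"
  shows "\<exists>B. lempert \<Omega> a w \<le> ereal B"
proof -
  obtain \<rho> where \<rho>: "dist a w < \<rho>" "\<rho> < r"
    using assms(2) dense by auto
  then have "0 < \<rho>" by (meson dual_order.strict_trans2 zero_le_dist)
  define \<alpha> where "\<alpha> = complex_of_real (dist a w / \<rho>)"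
  define s where "s = (\<rho> / dist a w) *\<^sub>R (w - a)"
  define \<phi> where "\<phi> = (\<lambda>\<zeta>. a + \<zeta> *s s)"
  have ns: "norm s \<le> \<rho>"
    using \<open>0 < \<rho>\<close> by (simp add: s_def dist_norm norm_minus_commute)
  have "\<phi> \<zeta> \<in> \<Omega>" if "\<zeta> \<in> ball 0 1" for \<zeta>
  proof -
    have "norm (\<zeta> *s s) = cmod \<zeta> * norm s"
      unfolding norm_vec_def by (simp add: norm_mult L2_set_right_distrib)
    also have "\<dots> \<le> 1 * \<rho>"
      using that ns \<open>0 < \<rho>\<close> by (intro mult_mono) auto
    finally have "\<phi> \<zeta> \<in> ball a r"
      using \<rho> by (simp add: \<phi>_def dist_norm)
    then show ?thesis using assms(1) by blast
  qed
  moreover have "(\<lambda>\<zeta>. \<phi> \<zeta> $ i) holomorphic_on ball 0 1" for i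
    by (simp add: \<phi>_def) (intro holomorphic_intros)
  ultimately have "holomorphic_disc \<Omega> \<phi>"
    by (auto simp: holomorphic_disc_def)
  moreover have "\<phi> 0 = a" by (simp add: \<phi>_def)
  moreover have "\<phi> \<alpha> = w"
  proof (cases "w = a")
    case False
    have "s $ i = complex_of_real (\<rho> / dist a w) * (w $ i - a $ i)" for i
      unfolding s_def vector_scaleR_component by (simp add: scaleR_conv_of_real)
    with False \<open>0 < \<rho>\<close> show ?thesis
      by (simp add: \<phi>_def \<alpha>_def Finite_Cartesian_Product.vec_eq_iff)
  qed (simp add: \<phi>_def s_def)
  moreover have "\<alpha> \<in> ball 0 1"
    using \<rho> \<open>0 < \<rho>\<close> by (simp add: \<alpha>_def norm_divide)
  ultimately have "lempert \<Omega> a w \<le> ereal (artanh (cmod \<alpha>))"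
    unfolding lempert_def by (intro Inf_lower) blast
  then show ?thesis by blast
qed

lemma below_lempert_bounded:
  assumes "is_domain \<Omega>" "z \<in> \<Omega>" "w \<in> \<Omega>"
  shows "\<exists>B. \<forall>d. below_lempert \<Omega> d \<longrightarrow> d z w \<le> B"
proof (rule connected_equivalence_relation[where S = \<Omega> and
      R = "\<lambda>z w. \<exists>B. \<forall>d. below_lempert \<Omega> d \<longrightarrow> d z w \<le> B"])
  show "connected \<Omega>" using assms by (simp add: is_domain_def)
  show "\<exists>B. \<forall>d. below_lempert \<Omega> d \<longrightarrow> d y x \<le> B"
    if "\<exists>B. \<forall>d. below_lempert \<Omega> d \<longrightarrow> d x y \<le> B" "x \<in> \<Omega>" "y \<in> \<Omega>" for x y
  proof -
    have "d y x = d x y" if "below_lempert \<Omega> d" for d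
      using that \<open>x \<in> \<Omega>\<close> \<open>y \<in> \<Omega>\<close> by (simp add: below_lempert_def pseudodistance_on_def)
    with that(1) show ?thesis by metis
  qed
  show "\<exists>B. \<forall>d. below_lempert \<Omega> d \<longrightarrow> d x z \<le> B"
    if "\<exists>B. \<forall>d. below_lempert \<Omega> d \<longrightarrow> d x y \<le> B"
      "\<exists>B. \<forall>d. below_lempert \<Omega> d \<longrightarrow> d y z \<le> B" "x \<in> \<Omega>" "y \<in> \<Omega>" "z \<in> \<Omega>" for x y z
  proof -
    from that obtain B C where B: "\<And>d. below_lempert \<Omega> d \<Longrightarrow> d x y \<le> B"
      and C: "\<And>d. below_lempert \<Omega> d \<Longrightarrow> d y z \<le> C" by blast
    have "d x z \<le> B + C" if "below_lempert \<Omega> d" for d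
    proof -
      have "d x z \<le> d x y + d y z"
        using that \<open>x \<in> \<Omega>\<close> \<open>y \<in> \<Omega>\<close> \<open>z \<in> \<Omega>\<close>
        unfolding below_lempert_def pseudodistance_on_def by blast
      with B[OF that] C[OF that] show ?thesis by linarith
    qed
    then show ?thesis by blast
  qed
  show "\<exists>T. openin (top_of_set \<Omega>) T \<and> a \<in> T \<and>
          (\<forall>x\<in>T. \<exists>B. \<forall>d. below_lempert \<Omega> d \<longrightarrow> d a x \<le> B)" if "a \<in> \<Omega>" for a
  proof -
    have "open \<Omega>" using assms by (simp add: is_domain_def)
    with that obtain r where r: "r > 0" "ball a r \<subseteq> \<Omega>"
      by (meson open_contains_ball)
    have "\<exists>B. \<forall>d. below_lempert \<Omega> d \<longrightarrow> d a x \<le> B" if x: "x \<in> ball a r" for x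
    proof -
      obtain B where B: "lempert \<Omega> a x \<le> ereal B"
        using lempert_ball_finite[OF r(2) x] by blast
      have "d a x \<le> B" if "below_lempert \<Omega> d" for d
      proof -
        have "ereal (d a x) \<le> lempert \<Omega> a x"
          using that \<open>a \<in> \<Omega>\<close> x r(2) unfolding below_lempert_def by blast
        also note B
        finally show ?thesis by simp
      qed
      then show ?thesis by blast
    qed
    moreover have "openin (top_of_set \<Omega>) (ball a r)"
      using r(2) \<open>open \<Omega>\<close> by (simp add: openin_open_eq)
    ultimately show ?thesis using r(1) by (intro exI[of _ "ball a r"]) auto
  qed
qed (use assms in auto)

lemma kobayashi_greatest:
  assumes "is_domain \<Omega>" "below_lempert \<Omega> d" "z \<in> \<Omega>" "w \<in> \<Omega>"
  shows "d z w \<le> kobayashi \<Omega> z w"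
proof -
  obtain B where "\<forall>d. below_lempert \<Omega> d \<longrightarrow> d z w \<le> B"
    using below_lempert_bounded[OF assms(1,3,4)] by blast
  then have "bdd_above {d z w | d. below_lempert \<Omega> d}"
    by (auto intro!: bdd_aboveI[of _ B])
  then show ?thesis
    unfolding kobayashi_def using assms(2) by (auto intro!: cSup_upper)
qed

lemma kobayashi_le:
  assumes "\<And>d. below_lempert \<Omega> d \<Longrightarrow> d z w \<le> B"
  shows "kobayashi \<Omega> z w \<le> B"
  unfolding kobayashi_def
  using assms below_lempert_zero by (intro cSup_least) blast+

lemma kobayashi_below_lempert:
  assumes "is_domain \<Omega>"
  shows "below_lempert \<Omega> (kobayashi \<Omega>)"
proof -
  have nonneg: "0 \<le> kobayashi \<Omega> x y" if "x \<in> \<Omega>" "y \<in> \<Omega>" for x y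
    using kobayashi_greatest[OF assms below_lempert_zero that] .
  have le: "kobayashi \<Omega> x y \<le> kobayashi \<Omega> y x" if "x \<in> \<Omega>" "y \<in> \<Omega>" for x y
  proof (rule kobayashi_le)
    fix d assume d: "below_lempert \<Omega> d"
    then have "d x y = d y x"
      using that by (simp add: below_lempert_def pseudodistance_on_def)
    then show "d x y \<le> kobayashi \<Omega> y x"
      using kobayashi_greatest[OF assms d that(2,1)] by simp
  qed
  have refl: "kobayashi \<Omega> x x = 0" if "x \<in> \<Omega>" for x
  proof (rule antisym)
    show "kobayashi \<Omega> x x \<le> 0"
      using that by (intro kobayashi_le) (simp add: below_lempert_def pseudodistance_on_def)
  qed (use nonneg that in blast)
  have triangle: "kobayashi \<Omega> x z \<le> kobayashi \<Omega> x y + kobayashi \<Omega> y z"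
    if "x \<in> \<Omega>" "y \<in> \<Omega>" "z \<in> \<Omega>" for x y z
  proof (rule kobayashi_le)
    fix d assume d: "below_lempert \<Omega> d"
    then have "d x z \<le> d x y + d y z"
      using that unfolding below_lempert_def pseudodistance_on_def by blast
    also have "\<dots> \<le> kobayashi \<Omega> x y + kobayashi \<Omega> y z"
      using that by (intro add_mono kobayashi_greatest[OF assms d])
    finally show "d x z \<le> kobayashi \<Omega> x y + kobayashi \<Omega> y z" .
  qed
  have lempert: "ereal (kobayashi \<Omega> x y) \<le> lempert \<Omega> x y" if "x \<in> \<Omega>" "y \<in> \<Omega>" for x y
  proof (cases "lempert \<Omega> x y")
    case (real l)
    have "kobayashi \<Omega> x y \<le> l"
    proof (rule kobayashi_le)
      fix d assume "below_lempert \<Omega> d"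
      then have "ereal (d x y) \<le> lempert \<Omega> x y"
        using that unfolding below_lempert_def by blast
      then show "d x y \<le> l" using real by simp
    qed
    then show ?thesis using real by simp
  next
    case MInf
    then show ?thesis using lempert_nonneg[of \<Omega> x y] by simp
  qed simp
  show ?thesis
    unfolding below_lempert_def pseudodistance_on_def
    using nonneg le refl triangle lempert by (auto intro: antisym)
qed

lemma kobayashi_eq_0_iff:
  fixes \<Omega> :: "(complex ^ 'n) set"
  assumes "is_domain \<Omega>" "bounded \<Omega>" "z \<in> \<Omega>" "w \<in> \<Omega>"
  shows "kobayashi \<Omega> z w = 0 \<longleftrightarrow> z = w"
proof
  assume 0: "kobayashi \<Omega> z w = 0"
  obtain R where R: "R > 0" "\<And>x. x \<in> \<Omega> \<Longrightarrow> norm x < R"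
    using assms(2) bounded_pos_less by metis
  have "z $ i = w $ i" for i
  proof -
    let ?d = "\<lambda>x y :: complex ^ 'n. cmod (y $ i - x $ i) / (2 * R)"
    have tri: "?d x y \<le> ?d x u + ?d u y" for x y u
      using R(1) norm_triangle_ineq[of "y $ i - u $ i" "u $ i - x $ i"]
      by (simp add: field_simps)
    have le: "ereal (?d x y) \<le> lempert \<Omega> x y" for x y
      unfolding lempert_def
    proof (rule Inf_greatest, clarify)
      fix \<alpha> \<phi> assume \<alpha>: "\<alpha> \<in> ball (0::complex) 1" and \<phi>: "holomorphic_disc \<Omega> \<phi>"
      define f where "f = (\<lambda>\<zeta>. (\<phi> \<zeta> $ i - \<phi> 0 $ i) / complex_of_real (2 * R))"
      have "cmod (\<phi> \<zeta> $ i) < R" if "cmod \<zeta> < 1" for \<zeta>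
      proof -
        have "\<phi> \<zeta> \<in> \<Omega>" using \<phi> that by (auto simp: holomorphic_disc_def)
        then show ?thesis
          using R(2) Finite_Cartesian_Product.norm_nth_le[of "\<phi> \<zeta>" i] by fastforce
      qed
      note b = this
      have "cmod (f \<zeta>) < 1" if "cmod \<zeta> < 1" for \<zeta>
        using b[OF that] b[of 0] R(1) norm_triangle_ineq4[of "\<phi> \<zeta> $ i" "\<phi> 0 $ i"]
        by (simp add: f_def norm_divide norm_mult)
      moreover have "f holomorphic_on ball 0 1"
        using \<phi> R(1) unfolding f_def holomorphic_disc_def by (intro holomorphic_intros) auto
      moreover have "f 0 = 0" by (simp add: f_def)
      ultimately have "cmod (f \<alpha>) \<le> cmod \<alpha>"
        using \<alpha> Schwarz_Lemma(1)[of f \<alpha>] by simp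
      also have "\<dots> \<le> artanh (cmod \<alpha>)"
        using \<alpha> by (intro artanh_ge_self) auto
      finally show "ereal (?d (\<phi> 0) (\<phi> \<alpha>)) \<le> ereal (artanh (cmod \<alpha>))"
        using R(1) by (simp add: f_def norm_divide norm_mult)
    qed
    have "below_lempert \<Omega> ?d"
      unfolding below_lempert_def pseudodistance_on_def
      using R(1) by (intro conjI ballI tri le) (auto simp: norm_minus_commute)
    from kobayashi_greatest[OF assms(1) this assms(3,4)] 0 R(1)
    show ?thesis by (simp add: divide_le_0_iff)
  qed
  then show "z = w" by (simp add: vec_eq_iff)
next
  assume "z = w"
  then show "kobayashi \<Omega> z w = 0"
    using kobayashi_below_lempert[OF assms(1)] assms(3)
    by (simp add: below_lempert_def pseudodistance_on_def)
qed


section \<open>Quasi-isometric equivalence and Gromov hyperbolicity\<close>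

definition quasi_isometrically_equivalent ::
    "'a set \<Rightarrow> ('a \<Rightarrow> 'a \<Rightarrow> real) \<Rightarrow> ('a \<Rightarrow> 'a \<Rightarrow> real) \<Rightarrow> bool" where
  "quasi_isometrically_equivalent X d1 d2 \<longleftrightarrow>
     (\<exists>c1>0. \<exists>c2>0. \<forall>x\<in>X. \<forall>y\<in>X.
        inverse c1 * d1 x y - c2 \<le> d2 x y \<and> d2 x y \<le> c1 * d1 x y + c2)"

text \<open>The Gromov product is taken without the customary factor \<open>1/2\<close>.\<close>

definition gromov_product :: "('a \<Rightarrow> 'a \<Rightarrow> real) \<Rightarrow> 'a \<Rightarrow> 'a \<Rightarrow> 'a \<Rightarrow> real" where
  "gromov_product d x y z = d x z + d z y - d x y"

definition gromov_defect :: "('a \<Rightarrow> 'a \<Rightarrow> real) \<Rightarrow> 'a \<Rightarrow> 'a \<Rightarrow> 'a \<Rightarrow> 'a \<Rightarrow> real" where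
  "gromov_defect d p q x w =
     min (gromov_product d p x w) (gromov_product d x q w) - gromov_product d p q w"

definition gromov_hyperbolic :: "'a set \<Rightarrow> ('a \<Rightarrow> 'a \<Rightarrow> real) \<Rightarrow> bool" where
  "gromov_hyperbolic X d \<longleftrightarrow>
     bdd_above {gromov_defect d p q x w | p q x w. p \<in> X \<and> q \<in> X \<and> x \<in> X \<and> w \<in> X}"

definition gromov_k_hyperbolic :: "(complex ^ 'n) set \<Rightarrow> bool" where
  "gromov_k_hyperbolic \<Omega> \<longleftrightarrow> gromov_hyperbolic \<Omega> (kobayashi \<Omega>)"


section \<open>Defining functions and the Levi form\<close>

definition C2_on :: "'a::real_normed_vector set \<Rightarrow> ('a \<Rightarrow> real) \<Rightarrow> bool" where
  "C2_on U r \<longleftrightarrow>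
     (\<exists>(r' :: 'a \<Rightarrow> 'a \<Rightarrow>\<^sub>L real) (r'' :: 'a \<Rightarrow> 'a \<Rightarrow>\<^sub>L 'a \<Rightarrow>\<^sub>L real).
        (\<forall>x\<in>U. (r has_derivative blinfun_apply (r' x)) (at x)) \<and>
        (\<forall>x\<in>U. (r' has_derivative blinfun_apply (r'' x)) (at x)) \<and>
        continuous_on U r'')"

definition C2_defining_function :: "'a::real_normed_vector set \<Rightarrow> ('a \<Rightarrow> real) \<Rightarrow> bool" where
  "C2_defining_function D r \<longleftrightarrow>
     (\<exists>U. open U \<and> closure D \<subseteq> U \<and> C2_on U r \<and> D = {x \<in> U. r x < 0}) \<and>
     (\<forall>b\<in>frontier D. frechet_derivative r (at b) \<noteq> (\<lambda>v. 0))"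

text \<open>
  The Wirtinger derivatives in the \<open>j\<close>-th coordinate; \<open>axis j 1\<close> and \<open>axis j \<i>\<close> are the
  directions of its real and imaginary part.
\<close>

definition wirtinger :: "'n \<Rightarrow> (complex ^ 'n \<Rightarrow> complex) \<Rightarrow> complex ^ 'n \<Rightarrow> complex" where
  "wirtinger j f z =
     (frechet_derivative f (at z) (axis j 1) - \<i> * frechet_derivative f (at z) (axis j \<i>)) / 2"

definition wirtinger_bar :: "'n \<Rightarrow> (complex ^ 'n \<Rightarrow> complex) \<Rightarrow> complex ^ 'n \<Rightarrow> complex" where
  "wirtinger_bar j f z =
     (frechet_derivative f (at z) (axis j 1) + \<i> * frechet_derivative f (at z) (axis j \<i>)) / 2"

definition complex_hessian ::
    "(complex ^ 'n \<Rightarrow> real) \<Rightarrow> complex ^ 'n \<Rightarrow> complex ^ 'n \<Rightarrow> complex ^ 'n \<Rightarrow> complex" where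
  "complex_hessian r b X Y =
     (\<Sum>j\<in>UNIV. \<Sum>k\<in>UNIV.
        wirtinger j (wirtinger_bar k (\<lambda>z. complex_of_real (r z))) b * X $ j * cnj (Y $ k))"

definition complex_tangent_space ::
    "(complex ^ 'n \<Rightarrow> real) \<Rightarrow> complex ^ 'n \<Rightarrow> (complex ^ 'n) set" where
  "complex_tangent_space r b =
     {X. (\<Sum>j\<in>UNIV. wirtinger j (\<lambda>z. complex_of_real (r z)) b * X $ j) = 0}"

text \<open>
  Eigenvalues of the Levi form, i.e. of the self-adjoint operator that represents the
  restriction of the complex Hessian to the complex tangent space with respect to the standard
  Hermitian inner product. Another defining function multiplies the Levi form at \<open>b\<close>, and hence
  its eigenvalues, by a positive constant.
\<close>

definition levi_eigenvalue :: "(complex ^ 'n \<Rightarrow> real) \<Rightarrow> complex ^ 'n \<Rightarrow> real \<Rightarrow> bool" where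
  "levi_eigenvalue r b \<mu> \<longleftrightarrow>
     (\<exists>X \<in> complex_tangent_space r b. X \<noteq> 0 \<and>
        (\<forall>Y \<in> complex_tangent_space r b.
           complex_hessian r b X Y = complex_of_real \<mu> * (\<Sum>j\<in>UNIV. X $ j * cnj (Y $ j))))"

end

theory Submission
  imports Defs
begin

text \<open>
  Write \<open>\<Omega>\<close> for the complement of \<open>closure D\<close> in \<open>G\<close>. The distances \<open>k\<^sub>G\<close> and \<open>k\<^sub>\<Omega>\<close> differ
  on \<open>\<Omega>\<close> by a bounded amount: \<open>k\<^sub>G \<le> k\<^sub>\<Omega> \<le> k\<^sub>G + C\<close>. This is much more than a quasi-isometry,
  and since an additive error changes each Gromov product by a bounded amount it carries Gromov
  hyperbolicity from \<open>G\<close> to \<open>\<Omega>\<close> directly, without any stability theorem for quasi-geodesics.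

  The lower estimate holds because a disc in \<open>\<Omega>\<close> is a disc in \<open>G\<close>. The upper estimate has two
  ingredients.

  Near \<open>closure D\<close>, the Levi form supplies a bounded \<open>k\<^sub>\<Omega>\<close>-diameter. If \<open>X\<close> is a complex
  tangent direction at \<open>b\<close> in which the Levi form is positive, then a quadratic disc through a point
  \<open>z\<close> near \<open>b\<close> in a direction close to \<open>X\<close>, with the second-order term chosen so as to cancel
  the harmonic part of the Taylor polynomial of \<open>r\<close>, satisfies
  \<open>r (\<phi> \<zeta>) \<ge> r z + c \<bar>\<zeta>\<bar>\<^sup>2\<close>, with radius and constant uniform in \<open>z\<close>
  (\<open>exterior_disc\<close>). So it stays outside \<open>closure D\<close> and
  reaches a fixed compact subset of \<open>\<Omega>\<close> at half of its radius. Hence all points of \<open>\<Omega>\<close> near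
  \<open>closure D\<close> lie at bounded \<open>k\<^sub>\<Omega>\<close>-distance from one point (\<open>kobayashi_bounded_collar\<close>).
  The same discs show that \<open>- closure D\<close> has no bounded component: at a farthest point of such a
  component they would violate the maximum principle for the norm
  (\<open>connected_complement_closure\<close>). Unicoherence of the space then makes \<open>\<Omega>\<close> connected.

  Away from \<open>closure D\<close>, a disc \<open>\<phi>\<close> in \<open>G\<close> with \<open>\<phi> 0 = p\<close> maps the disc of radius \<open>tanh \<rho>\<close>
  into \<open>\<Omega>\<close> if \<open>\<rho>\<close> is the \<open>k\<^sub>G\<close>-distance of \<open>p\<close> from \<open>closure D\<close>. So a short
  step of length \<open>s\<close> in \<open>G\<close> has length at most \<open>s (1 + C exp (- 2 \<rho>))\<close> in \<open>\<Omega>\<close>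
  (\<open>kobayashi_complement_link_le\<close>). Along an almost shortest chain of such steps the distance from
  a base point \<open>o'\<close> in \<open>closure D\<close> grows linearly in both directions away from the vertex where it is
  smallest. So the excess sums to a constant
  (\<open>pseudodistance_le_along_almost_geodesic\<close>).
\<close>

section \<open>Elementary estimates\<close>

lemma artanh_real_nonneg: "0 \<le> x \<Longrightarrow> x < 1 \<Longrightarrow> 0 \<le> artanh (x::real)"
  using artanh_ge_self[of x] by simp

lemma artanh_real_mono:
  fixes x y :: real
  assumes "0 \<le> x" "x \<le> y" "y < 1"
  shows "artanh x \<le> artanh y"
proof (rule DERIV_nonneg_imp_nondecreasing[OF assms(2)])
  fix t assume "x \<le> t" "t \<le> y"
  with assms have "\<bar>t\<bar> < 1" by auto
  then have "(artanh has_real_derivative 1 / (1 - t\<^sup>2)) (at t)" "0 \<le> 1 / (1 - t\<^sup>2)"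
    by (auto intro!: derivative_eq_intros simp: abs_square_less_1 less_imp_le)
  then show "\<exists>D. (artanh has_real_derivative D) (at t) \<and> 0 \<le> D" by blast
qed

lemma tanh_artanh_real:
  fixes x :: real
  assumes "\<bar>x\<bar> < 1"
  shows "tanh (artanh x) = x"
proof -
  have p: "(1 + x) / (1 - x) > 0" using assms by (auto simp: field_simps)
  have "exp (- 2 * artanh x) = inverse ((1 + x) / (1 - x))"
    using p by (simp add: artanh_def exp_minus)
  then have e: "exp (- 2 * artanh x) = (1 - x) / (1 + x)" by (simp add: field_simps)
  have "1 + x \<noteq> 0" using assms by auto
  then show ?thesis unfolding tanh_real_altdef e by (simp add: field_simps)
qed

text \<open>
  The derivative of \<open>artanh\<close> is at most \<open>4 / 3\<close> on \<open>[0, 1 / 2]\<close>.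
\<close>

lemma artanh_scaled_le:
  fixes t R :: real
  assumes "0 \<le> t" "0 < R" "R \<le> 1" "t / R \<le> 1 / 2"
  shows "artanh (t / R) \<le> artanh t + 4 / 3 * (t / R - t)"
proof -
  have tR: "t \<le> t / R" using assms by (simp add: field_simps mult_left_le_one_le)
  have "artanh (t / R) - 4 / 3 * (t / R) \<le> artanh t - 4 / 3 * t"
  proof (rule DERIV_nonpos_imp_nonincreasing[OF tR])
    fix u assume u: "t \<le> u" "u \<le> t / R"
    then have u': "0 \<le> u" "u \<le> 1 / 2" using assms(1,4) by linarith+
    then have "u\<^sup>2 \<le> (1 / 2)\<^sup>2" by (intro power_mono)
    then have "1 / (1 - u\<^sup>2) \<le> 4 / 3" by (simp add: field_simps power2_eq_square)
    moreover have "((\<lambda>u. artanh u - 4 / 3 * u) has_real_derivative (1 / (1 - u\<^sup>2) - 4 / 3)) (at u)"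
      using u' by (auto intro!: derivative_eq_intros)
    ultimately show "\<exists>y. ((\<lambda>u. artanh u - 4 / 3 * u) has_real_derivative y) (at u) \<and> y \<le> 0"
      by (intro exI[of _ "1 / (1 - u\<^sup>2) - 4 / 3"]) auto
  qed
  then show ?thesis unfolding right_diff_distrib by linarith
qed

lemma one_minus_tanh_le: "1 - tanh (x::real) \<le> 2 * exp (- 2 * x)"
proof -
  have "1 - (1 - e) / (1 + e) \<le> 2 * e" if "e > 0" for e :: real
    using that by (simp add: field_simps)
  from this[of "exp (- 2 * x)"] show ?thesis
    unfolding tanh_real_altdef by simp
qed

section \<open>Holomorphic discs and the Kobayashi distance\<close>

lemma pseudodistance_onD:
  assumes "pseudodistance_on X d"
  shows "x \<in> X \<Longrightarrow> y \<in> X \<Longrightarrow> 0 \<le> d x y" "x \<in> X \<Longrightarrow> d x x = 0"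
    "x \<in> X \<Longrightarrow> y \<in> X \<Longrightarrow> d x y = d y x"
    "x \<in> X \<Longrightarrow> y \<in> X \<Longrightarrow> z \<in> X \<Longrightarrow> d x z \<le> d x y + d y z"
  using assms unfolding pseudodistance_on_def by blast+

lemma pseudodistance_kobayashi: "is_domain \<Omega> \<Longrightarrow> pseudodistance_on \<Omega> (kobayashi \<Omega>)"
  using kobayashi_below_lempert by (auto simp: below_lempert_def)

lemma below_lempert_disc:
  assumes "below_lempert \<Omega> d" "holomorphic_disc \<Omega> \<phi>" "cmod \<alpha> < 1"
  shows "d (\<phi> 0) (\<phi> \<alpha>) \<le> artanh (cmod \<alpha>)"
proof -
  have "\<phi> 0 \<in> \<Omega>" "\<phi> \<alpha> \<in> \<Omega>" using assms(2,3) by (auto simp: holomorphic_disc_def)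
  then have "ereal (d (\<phi> 0) (\<phi> \<alpha>)) \<le> lempert \<Omega> (\<phi> 0) (\<phi> \<alpha>)"
    using assms(1) by (auto simp: below_lempert_def)
  also have "\<dots> \<le> ereal (artanh (cmod \<alpha>))"
    unfolding lempert_def using assms(2,3) by (intro Inf_lower) auto
  finally show ?thesis by simp
qed

lemma below_lempertI:
  assumes "pseudodistance_on \<Omega> d"
    and "\<And>\<phi> \<alpha>. holomorphic_disc \<Omega> \<phi> \<Longrightarrow> cmod \<alpha> < 1 \<Longrightarrow> d (\<phi> 0) (\<phi> \<alpha>) \<le> artanh (cmod \<alpha>)"
  shows "below_lempert \<Omega> d"
  unfolding below_lempert_def lempert_def
  using assms by (auto intro!: Inf_greatest)

lemma kobayashi_disc_le:
  assumes "is_domain \<Omega>" "holomorphic_disc \<Omega> \<phi>" "cmod \<alpha> < 1"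
  shows "kobayashi \<Omega> (\<phi> 0) (\<phi> \<alpha>) \<le> artanh (cmod \<alpha>)"
  using below_lempert_disc[OF kobayashi_below_lempert] assms by blast

lemma kobayashi_scaled_disc_le:
  fixes \<phi> :: "complex \<Rightarrow> complex ^ 'n"
  assumes \<Omega>: "is_domain \<Omega>" and R: "0 < R" "cmod \<alpha> < R"
    and hol: "\<And>i. (\<lambda>\<zeta>. \<phi> \<zeta> $ i) holomorphic_on ball 0 R"
    and im: "\<And>\<zeta>. cmod \<zeta> < R \<Longrightarrow> \<phi> \<zeta> \<in> \<Omega>"
  shows "kobayashi \<Omega> (\<phi> 0) (\<phi> \<alpha>) \<le> artanh (cmod \<alpha> / R)"
proof -
  define \<psi> where "\<psi> = (\<lambda>\<zeta>. \<phi> (complex_of_real R * \<zeta>))"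
  have sc: "cmod (complex_of_real R * \<zeta>) < R" if "cmod \<zeta> < 1" for \<zeta>
    using that R(1) by (simp add: norm_mult)
  have "(\<lambda>\<zeta>. \<psi> \<zeta> $ i) holomorphic_on ball 0 1" for i
    unfolding \<psi>_def
    by (rule holomorphic_on_compose_gen[OF _ hol, unfolded o_def])
      (auto intro!: holomorphic_intros simp: sc)
  then have "holomorphic_disc \<Omega> \<psi>"
    using im sc by (auto simp: holomorphic_disc_def \<psi>_def)
  from kobayashi_disc_le[OF \<Omega> this, of "\<alpha> / complex_of_real R"] R show ?thesis
    by (simp add: \<psi>_def norm_divide)
qed

lemma holomorphic_disc_subset: "holomorphic_disc A \<phi> \<Longrightarrow> A \<subseteq> B \<Longrightarrow> holomorphic_disc B \<phi>"
  by (auto simp: holomorphic_disc_def)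

text \<open>
  Discs in the smaller domain are discs in the larger one.
\<close>

lemma kobayashi_antimono:
  assumes "is_domain A" "is_domain B" "A \<subseteq> B" "x \<in> A" "y \<in> A"
  shows "kobayashi B x y \<le> kobayashi A x y"
proof (rule kobayashi_greatest[OF assms(1) below_lempertI])
  have "x \<in> A \<Longrightarrow> x \<in> B" for x using assms(3) by blast
  then show "pseudodistance_on A (kobayashi B)"
    using pseudodistance_kobayashi[OF assms(2)] unfolding pseudodistance_on_def by blast
qed (use assms in \<open>auto intro!: kobayashi_disc_le dest: holomorphic_disc_subset\<close>)

lemma norm_complex_smult: "norm (c *s (v :: complex ^ 'n)) = cmod c * norm v"
  unfolding norm_vec_def by (simp add: norm_mult L2_set_right_distrib)

lemma kobayashi_ball_le:
  fixes a w :: "complex ^ 'n"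
  assumes \<Omega>: "is_domain \<Omega>" and r: "0 < r" "ball a r \<subseteq> \<Omega>" and w: "norm (w - a) < r / 2"
  shows "kobayashi \<Omega> a w \<le> artanh (1 / 2)"
proof (cases "w = a")
  case True
  have "a \<in> \<Omega>" using r by auto
  then show ?thesis
    using True pseudodistance_onD(2)[OF pseudodistance_kobayashi[OF \<Omega>]]
    by (simp add: artanh_real_nonneg)
next
  case False
  define \<phi> where "\<phi> = (\<lambda>\<zeta>::complex. a + \<zeta> *s (w - a))"
  define R where "R = r / norm (w - a)"
  have n: "norm (w - a) > 0" using False by simp
  have R: "0 < R" "2 < R" using n w r by (auto simp: R_def field_simps)
  have "kobayashi \<Omega> (\<phi> 0) (\<phi> 1) \<le> artanh (cmod 1 / R)"
  proof (rule kobayashi_scaled_disc_le[OF \<Omega> R(1)])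
    fix \<zeta> :: complex assume "cmod \<zeta> < R"
    then have "norm (\<zeta> *s (w - a)) < r"
      using n unfolding norm_complex_smult R_def by (simp add: field_simps)
    moreover have "dist a (\<phi> \<zeta>) = norm (\<zeta> *s (w - a))"
      unfolding \<phi>_def dist_norm by (metis add_diff_cancel_left' norm_minus_commute)
    ultimately have "\<phi> \<zeta> \<in> ball a r" by simp
    then show "\<phi> \<zeta> \<in> \<Omega>" using r(2) by blast
  qed (use R in \<open>auto simp: \<phi>_def intro!: holomorphic_intros\<close>)
  also have "\<dots> \<le> artanh (1 / 2)" using R by (intro artanh_real_mono) (auto simp: field_simps)
  finally show ?thesis by (simp add: \<phi>_def)
qed

text \<open>
  The distance is bounded on small balls, and finitely many of them cover \<open>K\<close>.
\<close>

lemma kobayashi_bounded_on_compact: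
  fixes \<Omega> K :: "(complex ^ 'n) set"
  assumes \<Omega>: "is_domain \<Omega>" and a: "a \<in> \<Omega>" and K: "compact K" "K \<subseteq> \<Omega>"
  shows "\<exists>B. \<forall>x\<in>K. kobayashi \<Omega> a x \<le> B"
proof -
  have "\<exists>r>0. ball x r \<subseteq> \<Omega>" if "x \<in> K" for x
    using that K(2) \<Omega> by (meson is_domain_def open_contains_ball subsetD)
  then obtain r where r: "\<And>x. x \<in> K \<Longrightarrow> 0 < r x" "\<And>x. x \<in> K \<Longrightarrow> ball x (r x) \<subseteq> \<Omega>" by metis
  have "K \<subseteq> \<Union>((\<lambda>x. ball x (r x / 2)) ` K)" using r(1) by fastforce
  then obtain F where F: "F \<subseteq> K" "finite F" "K \<subseteq> (\<Union>x\<in>F. ball x (r x / 2))"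
    using compactE_image[OF K(1), of K "\<lambda>x. ball x (r x / 2)"] by auto
  show ?thesis
  proof (intro exI ballI)
    fix x assume x: "x \<in> K"
    then obtain c where c: "c \<in> F" "x \<in> ball c (r c / 2)" using F(3) by blast
    then have cK: "c \<in> K" using F(1) by blast
    have "kobayashi \<Omega> a x \<le> kobayashi \<Omega> a c + kobayashi \<Omega> c x"
      using pseudodistance_onD(4)[OF pseudodistance_kobayashi[OF \<Omega>] a] cK x K(2) by blast
    also have "\<dots> \<le> (\<Sum>c\<in>F. kobayashi \<Omega> a c) + artanh (1 / 2)"
    proof (rule add_mono)
      show "kobayashi \<Omega> a c \<le> (\<Sum>c\<in>F. kobayashi \<Omega> a c)"
        using pseudodistance_onD(1)[OF pseudodistance_kobayashi[OF \<Omega>] a] c(1) F(1,2) K(2)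
        by (intro member_le_sum) auto
      show "kobayashi \<Omega> c x \<le> artanh (1 / 2)"
        using c(2) by (intro kobayashi_ball_le[OF \<Omega> r[OF cK]]) (simp add: dist_norm norm_minus_commute)
    qed
    finally show "kobayashi \<Omega> a x \<le> (\<Sum>c\<in>F. kobayashi \<Omega> a c) + artanh (1 / 2)" .
  qed
qed

text \<open>
  The Schwarz lemma bounds each coordinate of a disc in a bounded domain. Summing over the coordinates
  gives the Euclidean norm.
\<close>

lemma norm_le_kobayashi:
  fixes \<Omega> :: "(complex ^ 'n) set"
  assumes \<Omega>: "is_domain \<Omega>" "bounded \<Omega>"
  shows "\<exists>C>0. \<forall>z\<in>\<Omega>. \<forall>w\<in>\<Omega>. norm (w - z) \<le> C * kobayashi \<Omega> z w"
proof -
  obtain R where R: "R > 0" "\<And>x. x \<in> \<Omega> \<Longrightarrow> norm x < R"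
    using \<Omega>(2) bounded_pos_less by metis
  have comp: "cmod (w $ i - z $ i) \<le> 2 * R * kobayashi \<Omega> z w" if "z \<in> \<Omega>" "w \<in> \<Omega>" for z w i
  proof -
    let ?d = "\<lambda>x y :: complex ^ 'n. cmod (y $ i - x $ i) / (2 * R)"
    have tri: "?d x y \<le> ?d x u + ?d u y" for x y u
      using R(1) norm_triangle_ineq[of "y $ i - u $ i" "u $ i - x $ i"]
      by (simp add: field_simps)
    have le: "?d (\<phi> 0) (\<phi> \<alpha>) \<le> artanh (cmod \<alpha>)"
      if \<phi>: "holomorphic_disc \<Omega> \<phi>" and \<alpha>: "cmod \<alpha> < 1" for \<phi> \<alpha>
    proof -
      define f where "f = (\<lambda>\<zeta>. (\<phi> \<zeta> $ i - \<phi> 0 $ i) / complex_of_real (2 * R))"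
      have b: "cmod (\<phi> \<zeta> $ i) < R" if "cmod \<zeta> < 1" for \<zeta>
      proof -
        have "\<phi> \<zeta> \<in> \<Omega>" using \<phi> that by (auto simp: holomorphic_disc_def)
        then show ?thesis
          using R(2) Finite_Cartesian_Product.norm_nth_le[of "\<phi> \<zeta>" i] by fastforce
      qed
      have "cmod (f \<zeta>) < 1" if "cmod \<zeta> < 1" for \<zeta>
        using b[OF that] b[of 0] R(1) norm_triangle_ineq4[of "\<phi> \<zeta> $ i" "\<phi> 0 $ i"]
        by (simp add: f_def norm_divide norm_mult)
      moreover have "f holomorphic_on ball 0 1"
        using \<phi> R(1) unfolding f_def holomorphic_disc_def by (intro holomorphic_intros) auto
      moreover have "f 0 = 0" by (simp add: f_def)
      ultimately have "cmod (f \<alpha>) \<le> cmod \<alpha>"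
        using \<alpha> Schwarz_Lemma(1)[of f \<alpha>] by simp
      also have "\<dots> \<le> artanh (cmod \<alpha>)"
        using \<alpha> by (intro artanh_ge_self) auto
      finally show ?thesis using R(1) by (simp add: f_def norm_divide norm_mult)
    qed
    have "below_lempert \<Omega> ?d"
    proof (rule below_lempertI[OF _ le])
      show "pseudodistance_on \<Omega> ?d"
        unfolding pseudodistance_on_def
        using R(1) by (intro conjI ballI tri) (auto simp: norm_minus_commute)
    qed
    from kobayashi_greatest[OF \<Omega>(1) this that] R(1) show ?thesis by (simp add: field_simps)
  qed
  have "norm (w - z) \<le> real CARD('n) * (2 * R) * kobayashi \<Omega> z w" if "z \<in> \<Omega>" "w \<in> \<Omega>" for z w
  proof -
    have "norm (w - z) \<le> (\<Sum>i\<in>UNIV. cmod (w $ i - z $ i))"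
      unfolding norm_vec_def by (simp add: L2_set_le_sum)
    also have "\<dots> \<le> (\<Sum>i\<in>(UNIV::'n set). 2 * R * kobayashi \<Omega> z w)"
      by (intro sum_mono comp that)
    finally show ?thesis by simp
  qed
  then show ?thesis using R(1) by (intro exI[of _ "real CARD('n) * (2 * R)"]) auto
qed

section \<open>Almost shortest chains of discs\<close>

lemma one_plus_cnj_mult_neq_0:
  assumes "cmod \<beta> < 1" "cmod \<zeta> < 1"
  shows "1 + cnj \<beta> * \<zeta> \<noteq> 0"
proof
  assume "1 + cnj \<beta> * \<zeta> = 0"
  then have "cnj \<beta> * \<zeta> = - 1" by (simp add: add_eq_0_iff)
  then have "cmod (cnj \<beta> * \<zeta>) = 1" by simp
  then have "cmod \<beta> * cmod \<zeta> = 1" by (simp add: norm_mult)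
  moreover have "cmod \<beta> * cmod \<zeta> < 1 * 1"
    by (rule mult_strict_mono') (use assms in auto)
  ultimately show False by simp
qed

lemma norm_moebius_less_1:
  assumes "cmod \<beta> < 1" "cmod \<zeta> < 1"
  shows "cmod ((\<zeta> + \<beta>) / (1 + cnj \<beta> * \<zeta>)) < 1"
proof -
  have "(cmod (1 + cnj \<beta> * \<zeta>))\<^sup>2 - (cmod (\<zeta> + \<beta>))\<^sup>2 = (1 - (cmod \<beta>)\<^sup>2) * (1 - (cmod \<zeta>)\<^sup>2)"
    unfolding cmod_power2 by (simp add: power2_eq_square algebra_simps)
  moreover have "(cmod \<beta>)\<^sup>2 < 1" "(cmod \<zeta>)\<^sup>2 < 1"
    using assms by (simp_all add: power_less_one_iff)
  then have "(1 - (cmod \<beta>)\<^sup>2) * (1 - (cmod \<zeta>)\<^sup>2) > 0" by simp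
  ultimately have "(cmod (\<zeta> + \<beta>))\<^sup>2 < (cmod (1 + cnj \<beta> * \<zeta>))\<^sup>2" by linarith
  then have "cmod (\<zeta> + \<beta>) < cmod (1 + cnj \<beta> * \<zeta>)"
    by (rule power2_less_imp_less) (rule norm_ge_zero)
  moreover from this have "cmod (1 + cnj \<beta> * \<zeta>) > 0" using norm_ge_zero le_less_trans by blast
  ultimately show ?thesis unfolding norm_divide by (simp only: divide_less_eq_1_pos)
qed

lemma holomorphic_disc_compose:
  assumes "holomorphic_disc \<Omega> \<phi>" "m holomorphic_on ball 0 1" "m ` ball 0 1 \<subseteq> ball 0 1"
  shows "holomorphic_disc \<Omega> (\<lambda>\<zeta>. \<phi> (m \<zeta>))"
proof -
  have "(\<lambda>\<zeta>. \<phi> (m \<zeta>) $ i) holomorphic_on ball 0 1" for i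
    using assms holomorphic_on_compose_gen[of m "ball 0 1" "\<lambda>\<zeta>. \<phi> \<zeta> $ i" "ball 0 1"]
    by (simp add: holomorphic_disc_def o_def)
  moreover have "\<phi> (m \<zeta>) \<in> \<Omega>" if "\<zeta> \<in> ball 0 1" for \<zeta>
    using assms(1,3) that unfolding holomorphic_disc_def by blast
  ultimately show ?thesis unfolding holomorphic_disc_def by blast
qed

lemma holomorphic_disc_moebius:
  assumes "holomorphic_disc \<Omega> \<phi>" "cmod \<beta> < 1"
  shows "holomorphic_disc \<Omega> (\<lambda>\<zeta>. \<phi> ((\<zeta> + \<beta>) / (1 + cnj \<beta> * \<zeta>)))"
proof (rule holomorphic_disc_compose[OF assms(1)])
  show "(\<lambda>\<zeta>. (\<zeta> + \<beta>) / (1 + cnj \<beta> * \<zeta>)) holomorphic_on ball 0 1"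
  proof (intro holomorphic_intros)
    fix \<zeta> :: complex assume "\<zeta> \<in> ball 0 1"
    then show "1 + cnj \<beta> * \<zeta> \<noteq> 0" by (intro one_plus_cnj_mult_neq_0 assms(2)) simp
  qed
  show "(\<lambda>\<zeta>. (\<zeta> + \<beta>) / (1 + cnj \<beta> * \<zeta>)) ` ball 0 1 \<subseteq> ball 0 1"
  proof (rule image_subsetI)
    fix \<zeta> :: complex assume "\<zeta> \<in> ball 0 1"
    then have "cmod \<zeta> < 1" by simp
    from norm_moebius_less_1[OF assms(2) this]
    show "(\<zeta> + \<beta>) / (1 + cnj \<beta> * \<zeta>) \<in> ball 0 1" by (simp only: mem_ball dist_0_norm)
  qed
qed

text \<open>
  A step of hyperbolic length \<open>s\<close> along a holomorphic disc. The bound \<open>\<epsilon>\<close> is kept as a parameter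
  because the later estimates concern short steps only.
\<close>

definition disc_link ::
  "(complex ^ 'n) set \<Rightarrow> real \<Rightarrow> complex ^ 'n \<Rightarrow> complex ^ 'n \<Rightarrow> real \<Rightarrow> bool" where
  "disc_link \<Omega> \<epsilon> p q s \<longleftrightarrow>
     (\<exists>\<phi> \<alpha>. holomorphic_disc \<Omega> \<phi> \<and> cmod \<alpha> < 1 \<and> \<phi> 0 = p \<and> \<phi> \<alpha> = q \<and>
        s = artanh (cmod \<alpha>) \<and> s \<le> \<epsilon>)"

lemma disc_link_mem: "disc_link \<Omega> \<epsilon> p q s \<Longrightarrow> p \<in> \<Omega> \<and> q \<in> \<Omega>"
  by (auto simp: disc_link_def holomorphic_disc_def)

lemma disc_link_nonneg: "disc_link \<Omega> \<epsilon> p q s \<Longrightarrow> 0 \<le> s"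
  by (auto simp: disc_link_def artanh_real_nonneg)

lemma disc_link_sym:
  assumes "disc_link \<Omega> \<epsilon> p q s"
  shows "disc_link \<Omega> \<epsilon> q p s"
proof -
  obtain \<phi> \<alpha> where \<phi>: "holomorphic_disc \<Omega> \<phi>" and \<alpha>: "cmod \<alpha> < 1" "\<phi> 0 = p" "\<phi> \<alpha> = q"
      "s = artanh (cmod \<alpha>)" "s \<le> \<epsilon>"
    using assms by (auto simp: disc_link_def)
  have "holomorphic_disc \<Omega> (\<lambda>\<zeta>. \<phi> (- \<zeta>))"
    by (rule holomorphic_disc_compose[OF \<phi>]) (auto intro!: holomorphic_intros)
  from holomorphic_disc_moebius[OF this, of "- \<alpha>"] \<alpha>(1)
  have "holomorphic_disc \<Omega> (\<lambda>\<zeta>. \<phi> (- ((\<zeta> - \<alpha>) / (1 - cnj \<alpha> * \<zeta>))))" by simp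
  moreover have "\<phi> (- ((0 - \<alpha>) / (1 - cnj \<alpha> * 0))) = q" "\<phi> (- ((\<alpha> - \<alpha>) / (1 - cnj \<alpha> * \<alpha>))) = p"
    using \<alpha> by simp_all
  ultimately show ?thesis unfolding disc_link_def using \<alpha>(1,4,5) by blast
qed

text \<open>
  The Moebius transformation that moves \<open>0\<close> to \<open>tanh a\<close> along a diameter translates the
  hyperbolic parameter by \<open>a\<close>, by the addition theorem for \<open>tanh\<close>.
\<close>

lemma disc_link_along_ray:
  assumes "holomorphic_disc \<Omega> \<phi>" "cmod u = 1" "0 \<le> t" "t \<le> \<epsilon>"
  shows "disc_link \<Omega> \<epsilon> (\<phi> (of_real (tanh a) * u)) (\<phi> (of_real (tanh (a + t)) * u)) t"
proof -
  have u: "cnj u * u = 1"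
    using assms(2) complex_norm_square[of u] by (simp add: mult.commute)
  have n: "cmod (complex_of_real (tanh x) * u) < 1" for x
    using tanh_real_bounds[of x] assms(2) by (auto simp: norm_mult)
  define \<beta> where "\<beta> = complex_of_real (tanh a) * u"
  define \<alpha> where "\<alpha> = complex_of_real (tanh t) * u"
  have "cnj \<beta> * \<alpha> = complex_of_real (tanh a * tanh t) * (cnj u * u)"
    by (simp add: \<alpha>_def \<beta>_def)
  then have "(\<alpha> + \<beta>) / (1 + cnj \<beta> * \<alpha>)
      = complex_of_real ((tanh a + tanh t) / (1 + tanh a * tanh t)) * u"
    unfolding u by (simp add: \<alpha>_def \<beta>_def algebra_simps)
  also have "(tanh a + tanh t) / (1 + tanh a * tanh t) = tanh (a + t)"
    by (simp add: tanh_add)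
  finally have "(\<alpha> + \<beta>) / (1 + cnj \<beta> * \<alpha>) = of_real (tanh (a + t)) * u" .
  then have stop: "\<phi> ((\<alpha> + \<beta>) / (1 + cnj \<beta> * \<alpha>)) = \<phi> (of_real (tanh (a + t)) * u)" by simp
  have start: "\<phi> ((0 + \<beta>) / (1 + cnj \<beta> * 0)) = \<phi> (of_real (tanh a) * u)"
    by (simp add: \<beta>_def)
  have len: "t = artanh (cmod \<alpha>)"
    using assms(2,3) by (simp add: \<alpha>_def norm_mult artanh_tanh_real)
  have "cmod \<alpha> < 1" "cmod \<beta> < 1" using n by (simp_all add: \<alpha>_def \<beta>_def)
  then show ?thesis
    unfolding disc_link_def
    using holomorphic_disc_moebius[OF assms(1), of \<beta>] start stop len assms(4) by blast
qed

inductive disc_chain ::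
  "(complex ^ 'n) set \<Rightarrow> real \<Rightarrow> complex ^ 'n \<Rightarrow> complex ^ 'n \<Rightarrow> real \<Rightarrow> bool" for \<Omega> \<epsilon> where
  disc_chain_refl: "x \<in> \<Omega> \<Longrightarrow> disc_chain \<Omega> \<epsilon> x x 0"
| disc_chain_step: "disc_chain \<Omega> \<epsilon> x y L \<Longrightarrow> disc_link \<Omega> \<epsilon> y z s \<Longrightarrow> disc_chain \<Omega> \<epsilon> x z (L + s)"

lemma disc_chain_trans:
  assumes "disc_chain \<Omega> \<epsilon> y z L'" "disc_chain \<Omega> \<epsilon> x y L"
  shows "disc_chain \<Omega> \<epsilon> x z (L + L')"
  using assms
  by (induction rule: disc_chain.induct) (auto simp: add.assoc[symmetric] intro: disc_chain_step)

lemma disc_chain_sym: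
  assumes "disc_chain \<Omega> \<epsilon> x y L"
  shows "disc_chain \<Omega> \<epsilon> y x L"
  using assms
proof (induction rule: disc_chain.induct)
  case (disc_chain_step x y L z s)
  have "disc_chain \<Omega> \<epsilon> z y (0 + s)"
    using disc_link_sym[OF disc_chain_step.hyps(2)] disc_link_mem[OF disc_chain_step.hyps(2)]
    by (intro disc_chain.disc_chain_step[OF disc_chain_refl]) auto
  from disc_chain_trans[OF disc_chain_step.IH this] show ?case by (simp add: add.commute)
qed (rule disc_chain_refl)

lemma disc_chain_nonneg: "disc_chain \<Omega> \<epsilon> x y L \<Longrightarrow> 0 \<le> L"
  by (induction rule: disc_chain.induct) (auto dest: disc_link_nonneg)

text \<open>
  A hyperbolic segment can be cut into arbitrarily short pieces without changing its total
  length. So restricting chains to short steps does not change the distance they define.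
\<close>

lemma disc_chain_of_disc:
  assumes \<phi>: "holomorphic_disc \<Omega> \<phi>" and \<alpha>: "cmod \<alpha> < 1" and \<epsilon>: "0 < \<epsilon>"
  shows "disc_chain \<Omega> \<epsilon> (\<phi> 0) (\<phi> \<alpha>) (artanh (cmod \<alpha>))"
proof -
  define u where "u = (if \<alpha> = 0 then 1 else \<alpha> / complex_of_real (cmod \<alpha>))"
  have u: "cmod u = 1" "complex_of_real (cmod \<alpha>) * u = \<alpha>"
    by (auto simp: u_def norm_divide)
  define s where "s = artanh (cmod \<alpha>)"
  have s: "0 \<le> s" using \<alpha> by (simp add: s_def artanh_real_nonneg)
  obtain N :: nat where N: "s / \<epsilon> < real N" using reals_Archimedean2 by blast
  have N0: "0 < real N" using N s \<epsilon> by (smt (verit) divide_nonneg_pos)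
  define t where "t = s / real N"
  have t: "0 \<le> t" "t \<le> \<epsilon>" using N N0 s \<epsilon> by (auto simp: t_def field_simps)
  have "disc_chain \<Omega> \<epsilon> (\<phi> 0) (\<phi> (of_real (tanh (real k * t)) * u)) (real k * t)" for k
  proof (induction k)
    case 0
    have "\<phi> 0 \<in> \<Omega>" using \<phi> by (auto simp: holomorphic_disc_def)
    then show ?case by (simp add: disc_chain_refl)
  next
    case (Suc k)
    from disc_chain_step[OF Suc disc_link_along_ray[OF \<phi> u(1) t]]
    show ?case by (simp add: algebra_simps)
  qed
  from this[of N] N0 have "disc_chain \<Omega> \<epsilon> (\<phi> 0) (\<phi> (of_real (tanh s) * u)) s"
    by (simp add: t_def)
  then show ?thesis using \<alpha> u(2) by (simp add: s_def tanh_artanh_real)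
qed

lemma disc_chain_exists:
  fixes \<Omega> :: "(complex ^ 'n) set"
  assumes \<Omega>: "is_domain \<Omega>" and \<epsilon>: "0 < \<epsilon>" and xy: "x \<in> \<Omega>" "y \<in> \<Omega>"
  shows "\<exists>L. disc_chain \<Omega> \<epsilon> x y L"
proof (rule connected_equivalence_relation[where S = \<Omega> and R = "\<lambda>x y. \<exists>L. disc_chain \<Omega> \<epsilon> x y L"])
  show "\<exists>T. openin (top_of_set \<Omega>) T \<and> a \<in> T \<and> (\<forall>x\<in>T. \<exists>L. disc_chain \<Omega> \<epsilon> a x L)"
    if a: "a \<in> \<Omega>" for a
  proof -
    obtain r where r: "0 < r" "ball a r \<subseteq> \<Omega>"
      using \<Omega> a by (meson is_domain_def open_contains_ball)
    have "\<exists>L. disc_chain \<Omega> \<epsilon> a x L" if x: "x \<in> ball a r" for x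
    proof -
      obtain B where "lempert \<Omega> a x \<le> ereal B"
        using lempert_ball_finite[OF r(2) x] by blast
      then have "lempert \<Omega> a x < \<infinity>" by auto
      then obtain \<phi> \<alpha> where "holomorphic_disc \<Omega> \<phi>" "cmod \<alpha> < 1" "\<phi> 0 = a" "\<phi> \<alpha> = x"
        unfolding lempert_def Inf_less_iff by auto
      then show ?thesis using disc_chain_of_disc \<epsilon> by blast
    qed
    then show ?thesis
      using r \<Omega> by (intro exI[of _ "ball a r"]) (auto simp: is_domain_def openin_open_eq)
  qed
  show "connected \<Omega>" using \<Omega> by (simp add: is_domain_def)
  show "\<exists>L. disc_chain \<Omega> \<epsilon> y x L" if "\<exists>L. disc_chain \<Omega> \<epsilon> x y L" for x y
    using that disc_chain_sym by blast
  show "\<exists>L. disc_chain \<Omega> \<epsilon> x z L"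
    if "\<exists>L. disc_chain \<Omega> \<epsilon> x y L" "\<exists>L. disc_chain \<Omega> \<epsilon> y z L" for x y z
  proof -
    from that obtain L L' where "disc_chain \<Omega> \<epsilon> x y L" "disc_chain \<Omega> \<epsilon> y z L'" by blast
    from disc_chain_trans[OF this(2,1)] show ?thesis by blast
  qed
qed (use xy in simp_all)

text \<open>
  The infimum of the lengths of chains is itself a pseudodistance below the Lempert function,
  so it cannot exceed the Kobayashi distance.
\<close>

lemma disc_chain_almost_kobayashi:
  assumes \<Omega>: "is_domain \<Omega>" and \<epsilon>: "0 < \<epsilon>" "0 < \<delta>" and xy: "x \<in> \<Omega>" "y \<in> \<Omega>"
  obtains L where "disc_chain \<Omega> \<epsilon> x y L" "L < kobayashi \<Omega> x y + \<delta>"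
proof -
  \<comment> \<open>the length of a shortest chain\<close>
  define d where "d x y = Inf {L. disc_chain \<Omega> \<epsilon> x y L}" for x y
  have bdd: "bdd_below {L. disc_chain \<Omega> \<epsilon> x y L}" for x y
    by (rule bdd_belowI[of _ 0]) (auto dest: disc_chain_nonneg)
  have d_le: "d x y \<le> L" if "disc_chain \<Omega> \<epsilon> x y L" for x y L
    unfolding d_def using that by (intro cInf_lower bdd) auto
  have near: "\<exists>L. disc_chain \<Omega> \<epsilon> x y L \<and> L < d x y + e" if "x \<in> \<Omega>" "y \<in> \<Omega>" "0 < e" for x y e
    using cInf_lessD[of "{L. disc_chain \<Omega> \<epsilon> x y L}" "d x y + e"]
      disc_chain_exists[OF \<Omega> \<epsilon>(1) that(1,2)] that(3) by (auto simp: d_def)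
  have nonneg: "0 \<le> d x y" if "x \<in> \<Omega>" "y \<in> \<Omega>" for x y
    unfolding d_def using disc_chain_exists[OF \<Omega> \<epsilon>(1) that]
    by (intro cInf_greatest) (auto dest: disc_chain_nonneg)
  have "below_lempert \<Omega> d"
  proof (rule below_lempertI)
    show "d (\<phi> 0) (\<phi> \<alpha>) \<le> artanh (cmod \<alpha>)" if "holomorphic_disc \<Omega> \<phi>" "cmod \<alpha> < 1" for \<phi> \<alpha>
      by (intro d_le disc_chain_of_disc that \<epsilon>)
    have "{L. disc_chain \<Omega> \<epsilon> x y L} = {L. disc_chain \<Omega> \<epsilon> y x L}" for x y
      using disc_chain_sym by blast
    then have sym: "d x y = d y x" for x y by (simp add: d_def)
    have refl: "d x x = 0" if "x \<in> \<Omega>" for x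
      using d_le[OF disc_chain_refl[OF that]] nonneg[OF that that] by simp
    have tri: "d x z \<le> d x y + d y z" if xyz: "x \<in> \<Omega>" "y \<in> \<Omega>" "z \<in> \<Omega>" for x y z
    proof (rule field_le_epsilon)
      fix e :: real assume "0 < e"
      then obtain L L' where "disc_chain \<Omega> \<epsilon> x y L" "L < d x y + e / 2"
        "disc_chain \<Omega> \<epsilon> y z L'" "L' < d y z + e / 2"
        using near[OF xyz(1,2), of "e / 2"] near[OF xyz(2,3), of "e / 2"] by auto
      then show "d x z \<le> d x y + d y z + e"
        using d_le[OF disc_chain_trans[of \<Omega> \<epsilon> y z L' x L]] by linarith
    qed
    show "pseudodistance_on \<Omega> d"
      unfolding pseudodistance_on_def using sym by (intro conjI ballI nonneg refl tri) auto
  qed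
  from kobayashi_greatest[OF \<Omega> this xy] near[OF xy \<epsilon>(2)] show ?thesis
    using that by force
qed

lemma disc_chain_sequence:
  assumes "disc_chain \<Omega> \<epsilon> x y L"
  shows "\<exists>m p s. p 0 = x \<and> p m = y \<and> (\<forall>i<m. disc_link \<Omega> \<epsilon> (p i) (p (Suc i)) (s i)) \<and>
           (\<forall>i\<le>m. p i \<in> \<Omega>) \<and> (\<Sum>i<m. s i) = L"
  using assms
proof (induction rule: disc_chain.induct)
  case (disc_chain_refl x)
  then show ?case by (intro exI[of _ "0::nat"] exI[of _ "\<lambda>_. x"] exI[of _ "\<lambda>_. 0"]) auto
next
  case (disc_chain_step x y L z t)
  then obtain m p s where *: "p 0 = x" "p m = y" "\<forall>i<m. disc_link \<Omega> \<epsilon> (p i) (p (Suc i)) (s i)"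
    "\<forall>i\<le>m. p i \<in> \<Omega>" "(\<Sum>i<m. s i) = L" by blast
  have "(\<Sum>i<m. (s(m := t)) i) = L" unfolding *(5)[symmetric] by (intro sum.cong) auto
  then show ?case
    using * disc_chain_step.hyps(2) disc_link_mem[OF disc_chain_step.hyps(2)]
    by (intro exI[of _ "Suc m"] exI[of _ "p(Suc m := z)"] exI[of _ "s(m := t)"])
      (auto simp: less_Suc_eq le_Suc_eq)
qed

section \<open>Comparison of pseudodistances along almost shortest chains\<close>

text \<open>
  A Riemann sum for the integral of \<open>1 / (1 + t\<^sup>2)\<close>. With steps of length at most \<open>1\<close> the
  integrand varies by a factor of at most \<open>3\<close> within a step, and the integral over the line is
  \<open>pi\<close>.
\<close>

lemma sum_reciprocal_quadratic_le:
  fixes s :: "nat \<Rightarrow> real"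
  assumes "\<And>i. i < m \<Longrightarrow> 0 \<le> s i \<and> s i \<le> 1"
  shows "(\<Sum>i<m. s i / (1 + ((\<Sum>j<i. s j) - a)\<^sup>2)) \<le> 3 * pi"
proof -
  define T where "T i = (\<Sum>j<i. s j) - a" for i
  have step: "s i / (1 + (T i)\<^sup>2) \<le> 3 * (arctan (T (Suc i)) - arctan (T i))" if i: "i < m" for i
  proof (cases "s i = 0")
    case False
    then have s: "0 < s i" "s i \<le> 1" using assms[OF i] by auto
    have T: "T (Suc i) = T i + s i" by (simp add: T_def)
    have "\<exists>z>T i. z < T (Suc i) \<and>
        arctan (T (Suc i)) - arctan (T i) = (T (Suc i) - T i) * inverse (1 + z\<^sup>2)"
      using s T by (intro MVT2) (auto intro: DERIV_arctan)
    then obtain z where z: "T i < z" "z < T i + s i"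
      "arctan (T (Suc i)) - arctan (T i) = s i / (1 + z\<^sup>2)"
      unfolding T by (auto simp: divide_inverse)
    have "(z - T i)\<^sup>2 \<le> 1" using z s by (simp add: power_le_one)
    moreover have "2 * (T i)\<^sup>2 + 2 * (z - T i)\<^sup>2 - z\<^sup>2 = (2 * T i - z)\<^sup>2"
      by (simp add: power2_eq_square algebra_simps)
    ultimately have "z\<^sup>2 \<le> 2 * (T i)\<^sup>2 + 2" using zero_le_power2[of "2 * T i - z"] by linarith
    then have le: "1 + z\<^sup>2 \<le> 3 * (1 + (T i)\<^sup>2)" using zero_le_power2[of "T i"]
      unfolding distrib_left by linarith
    have pos: "0 < 1 + z\<^sup>2" "0 < 1 + (T i)\<^sup>2" by (simp_all add: add_pos_nonneg)
    have "s i * (1 + z\<^sup>2) \<le> s i * (3 * (1 + (T i)\<^sup>2))"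
      using le s by (intro mult_left_mono) auto
    then have "s i / (1 + (T i)\<^sup>2) \<le> 3 * (s i / (1 + z\<^sup>2))"
      using pos by (simp add: field_simps)
    then show ?thesis using z(3) by simp
  qed (simp add: T_def)
  have "(\<Sum>i<m. s i / (1 + (T i)\<^sup>2)) \<le> (\<Sum>i<m. 3 * (arctan (T (Suc i)) - arctan (T i)))"
    using step by (intro sum_mono) auto
  also have "\<dots> = 3 * (arctan (T m) - arctan (T 0))"
    using sum_lessThan_telescope[of "\<lambda>i. arctan (T i)" m] by (simp only: sum_distrib_left[symmetric])
  also have "\<dots> \<le> 3 * pi" using arctan_bounded[of "T m"] arctan_bounded[of "T 0"] by simp
  finally show ?thesis by (simp add: T_def)
qed

text \<open>
  Replaces the exponential weight by one whose primitive, \<open>arctan\<close>, is smooth and bounded.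
\<close>

lemma exp_minus_abs_le: "exp (- \<bar>t\<bar>) \<le> 2 / (1 + t\<^sup>2)" for t :: real
proof -
  have "1 + t\<^sup>2 \<le> 2 * exp \<bar>t\<bar>" using exp_lower_Taylor_quadratic[of "\<bar>t\<bar>"] by simp
  moreover have "0 < 1 + t\<^sup>2" by (simp add: add_pos_nonneg)
  ultimately show ?thesis by (simp add: exp_minus field_simps)
qed

lemma pseudodistance_chain_le:
  assumes d: "pseudodistance_on X d" and p: "\<And>i. i \<le> n \<Longrightarrow> p i \<in> X" and "k \<le> n"
    and step: "\<And>i. k \<le> i \<Longrightarrow> i < n \<Longrightarrow> d (p i) (p (Suc i)) \<le> s i"
  shows "d (p k) (p n) \<le> (\<Sum>i=k..<n. s i)"
  using \<open>k \<le> n\<close> p step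
proof (induction n rule: dec_induct)
  case base
  then show ?case using pseudodistance_onD(2)[OF d] by simp
next
  case (step n)
  have "d (p k) (p (Suc n)) \<le> d (p k) (p n) + d (p n) (p (Suc n))"
    using step.prems(1) step.hyps(1) by (intro pseudodistance_onD(4)[OF d]) auto
  also have "\<dots> \<le> (\<Sum>i=k..<n. s i) + s n"
    using step by (intro add_mono) auto
  finally show ?case using step.hyps(1) by simp
qed

text \<open>
  Let \<open>T\<close> be the arc length along the chain, and let \<open>p i0\<close> be the vertex nearest to \<open>o'\<close>. As the
  chain is almost shortest, \<open>\<bar>T i - T i0\<bar> - 1 \<le> k (p i) (p i0)\<close>, and this is at most
  \<open>k (p i) o' + k (p i0) o' \<le> 2 * k (p i) o'\<close>. So the relative excess \<open>C * exp (- 2 * k (p i) o')\<close> of the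
  step decays exponentially in arc length on both sides of \<open>i0\<close>, and its sum is bounded
  independently of the chain.
\<close>

lemma pseudodistance_le_along_almost_geodesic:
  fixes s :: "nat \<Rightarrow> real"
  assumes k: "pseudodistance_on X k" and d: "pseudodistance_on X d" and o: "o' \<in> X" and C: "0 \<le> C"
    and p: "\<And>i. i \<le> m \<Longrightarrow> p i \<in> X"
    and s: "\<And>i. i < m \<Longrightarrow> 0 \<le> s i \<and> s i \<le> 1"
    and ks: "\<And>i. i < m \<Longrightarrow> k (p i) (p (Suc i)) \<le> s i"
    and almost: "(\<Sum>i<m. s i) \<le> k (p 0) (p m) + 1"
    and ds: "\<And>i. i < m \<Longrightarrow> d (p i) (p (Suc i)) \<le> s i * (1 + C * exp (- 2 * k (p i) o'))"
  shows "d (p 0) (p m) \<le> k (p 0) (p m) + 1 + 6 * pi * exp 1 * C"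
proof -
  define T where "T i = (\<Sum>j<i. s j)" for i
  have T_diff: "(\<Sum>l=i..<j. s l) = T j - T i" if "i \<le> j" for i j
    using that unfolding T_def
    by (metis add_diff_cancel_left' lessThan_atLeast0 sum.atLeastLessThan_concat zero_le)
  have k_le: "k (p i) (p j) \<le> T j - T i" if "i \<le> j" "j \<le> m" for i j
  proof -
    have "k (p i) (p j) \<le> (\<Sum>l=i..<j. s l)"
      using that by (intro pseudodistance_chain_le[OF k] p ks) auto
    then show ?thesis using that(1) by (simp add: T_diff)
  qed
  have T_le: "T j - T i \<le> k (p i) (p j) + 1" if ij: "i \<le> j" "j \<le> m" for i j
  proof -
    have "T m \<le> k (p 0) (p m) + 1" using almost by (simp add: T_def)
    moreover have "k (p 0) (p m) \<le> k (p 0) (p i) + k (p i) (p j) + k (p j) (p m)"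
      using pseudodistance_onD(4)[OF k p[of 0] p[of i] p[of m]]
        pseudodistance_onD(4)[OF k p[of i] p[of j] p[of m]] ij by simp
    moreover have "k (p 0) (p i) \<le> T i" using k_le[of 0 i] ij by (simp add: T_def)
    moreover have "k (p j) (p m) \<le> T m - T j" using k_le[of j m] ij by simp
    ultimately show ?thesis by linarith
  qed
  define u where "u i = k (p i) o'" for i
  have "\<exists>i0\<in>{..m}. \<forall>i\<in>{..m}. u i0 \<le> u i"
    using arg_min_if_finite[of "{..m}" u] by (intro bexI[of _ "arg_min_on u {..m}"]) (auto simp: not_less)
  then obtain i0 where i0: "i0 \<le> m" "\<And>i. i \<le> m \<Longrightarrow> u i0 \<le> u i" by auto
  \<comment> \<open>the vertices cannot stay close to \<open>o'\<close> for long\<close>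
  have far: "\<bar>T i - T i0\<bar> \<le> 2 * u i + 1" if "i \<le> m" for i
  proof -
    have sub: "k (p i) (p i0) \<le> u i + u i0"
      using pseudodistance_onD(4)[OF k p[OF that] o p[OF i0(1)]]
        pseudodistance_onD(3)[OF k o p[OF i0(1)]] by (simp add: u_def)
    have sym: "k (p i) (p i0) = k (p i0) (p i)"
      using pseudodistance_onD(3)[OF k p[OF that] p[OF i0(1)]] .
    have "T i - T i0 \<le> k (p i) (p i0) + 1 \<and> T i0 - T i \<le> k (p i) (p i0) + 1"
      using T_le[of i i0] T_le[of i0 i] that i0(1) k_le[of i i0] k_le[of i0 i] sym
        pseudodistance_onD(1)[OF k p[OF that] p[OF i0(1)]]
      by (cases "i \<le> i0") auto
    then show ?thesis using sub i0(2)[OF that] by linarith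
  qed
  have weight: "s i * (1 + C * exp (- 2 * u i))
      \<le> s i + 2 * exp 1 * C * (s i / (1 + (T i - T i0)\<^sup>2))" if i: "i < m" for i
  proof -
    have "exp (- 2 * u i) \<le> exp (1 - \<bar>T i - T i0\<bar>)" using far[of i] i by simp
    also have "\<dots> = exp 1 * exp (- \<bar>T i - T i0\<bar>)" by (simp add: exp_add[symmetric])
    also have "\<dots> \<le> exp 1 * (2 / (1 + (T i - T i0)\<^sup>2))"
      by (intro mult_left_mono exp_minus_abs_le) auto
    finally have "C * s i * exp (- 2 * u i) \<le> C * s i * (exp 1 * (2 / (1 + (T i - T i0)\<^sup>2)))"
      using C s[OF i] by (intro mult_left_mono) auto
    then show ?thesis by (simp add: algebra_simps)
  qed
  have "d (p 0) (p m) \<le> (\<Sum>i=0..<m. s i * (1 + C * exp (- 2 * u i)))"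
    using ds by (intro pseudodistance_chain_le[OF d] p) (auto simp: u_def)
  also have "\<dots> \<le> (\<Sum>i=0..<m. s i + 2 * exp 1 * C * (s i / (1 + (T i - T i0)\<^sup>2)))"
    by (intro sum_mono weight) auto
  also have "\<dots> = (\<Sum>i<m. s i) + 2 * exp 1 * C * (\<Sum>i<m. s i / (1 + (T i - T i0)\<^sup>2))"
    by (simp add: sum.distrib sum_distrib_left lessThan_atLeast0)
  also have "\<dots> \<le> (k (p 0) (p m) + 1) + 2 * exp 1 * C * (3 * pi)"
    using sum_reciprocal_quadratic_le[of m s "T i0"] s C
    by (intro add_mono almost mult_left_mono) (auto simp: T_def)
  finally show ?thesis by (simp add: algebra_simps)
qed

section \<open>Removing a compact set with a bounded collar\<close>

text \<open>
  The quotient pseudodistance in which the set where \<open>f\<close> vanishes is collapsed to a point: a path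
  from \<open>x\<close> to \<open>y\<close> may either go directly or pass through that point.
\<close>

lemma pseudodistance_collapse:
  assumes k: "pseudodistance_on Y k" and \<pi>: "\<And>x. x \<in> X \<Longrightarrow> \<pi> x \<in> Y"
    and f: "\<And>x. x \<in> Y \<Longrightarrow> (0::real) \<le> f x" "\<And>x y. x \<in> Y \<Longrightarrow> y \<in> Y \<Longrightarrow> f x \<le> f y + k x y"
  shows "pseudodistance_on X (\<lambda>x y. min (k (\<pi> x) (\<pi> y)) (f (\<pi> x) + f (\<pi> y)))"
  unfolding pseudodistance_on_def
proof (intro conjI ballI)
  fix x y z assume "x \<in> X" "y \<in> X" "z \<in> X"
  then have m: "\<pi> x \<in> Y" "\<pi> y \<in> Y" "\<pi> z \<in> Y" using \<pi> by auto
  show "min (k (\<pi> x) (\<pi> z)) (f (\<pi> x) + f (\<pi> z))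
      \<le> min (k (\<pi> x) (\<pi> y)) (f (\<pi> x) + f (\<pi> y)) + min (k (\<pi> y) (\<pi> z)) (f (\<pi> y) + f (\<pi> z))"
    using pseudodistance_onD(4)[OF k m] f(1)[OF m(2)] f(2)[OF m(1,2)] f(2)[OF m(3,2)]
      pseudodistance_onD(3)[OF k m(2,3)]
    by (auto simp: min_def)
qed (use pseudodistance_onD[OF k] \<pi> f in \<open>auto simp: min_def add.commute\<close>)

text \<open>
  The disc enters \<open>K\<close> only at points of hyperbolic distance at least \<open>\<rho>\<close> from the centre, since
  discs contract. Shrinking it to radius \<open>tanh \<rho>\<close> lengthens short steps by a factor close to
  \<open>1 / tanh \<rho>\<close>, which exceeds \<open>1\<close> by a multiple of \<open>exp (- 2 * \<rho>)\<close>.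
\<close>

lemma kobayashi_complement_link_le:
  fixes G K :: "(complex ^ 'n) set"
  assumes G: "is_domain G" and \<Omega>: "is_domain (G - K)"
    and \<phi>: "holomorphic_disc G \<phi>" and \<rho>: "0 < \<rho>0" "\<rho>0 \<le> \<rho>"
    and far: "\<And>x. x \<in> K \<Longrightarrow> \<rho> \<le> kobayashi G (\<phi> 0) x"
    and \<alpha>: "cmod \<alpha> < 1" "cmod \<alpha> \<le> tanh \<rho>0 / 2"
  shows "\<phi> 0 \<in> G - K" "\<phi> \<alpha> \<in> G - K"
    "kobayashi (G - K) (\<phi> 0) (\<phi> \<alpha>)
       \<le> artanh (cmod \<alpha>) * (1 + 8 / (3 * tanh \<rho>0) * exp (- 2 * \<rho>))"
proof -
  define R where "R = tanh \<rho>"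
  have R: "0 < tanh \<rho>0" "tanh \<rho>0 \<le> R" "R < 1"
    using \<rho> by (auto simp: R_def tanh_real_lt_1)
  then have R0: "0 < R" by linarith
  have avoid: "\<phi> \<zeta> \<in> G - K" if \<zeta>: "cmod \<zeta> < R" for \<zeta>
  proof -
    have \<zeta>1: "cmod \<zeta> < 1" using \<zeta> R by simp
    have "tanh (artanh (cmod \<zeta>)) < tanh \<rho>"
      using \<zeta> \<zeta>1 by (simp add: tanh_artanh_real R_def)
    then have "kobayashi G (\<phi> 0) (\<phi> \<zeta>) < \<rho>"
      using kobayashi_disc_le[OF G \<phi> \<zeta>1] by simp
    then show ?thesis using far \<phi> \<zeta>1 by (force simp: holomorphic_disc_def)
  qed
  have \<alpha>R: "cmod \<alpha> < R" using \<alpha>(2) R by linarith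
  show "\<phi> 0 \<in> G - K" "\<phi> \<alpha> \<in> G - K" using avoid[of 0] avoid[OF \<alpha>R] R by simp_all
  have s: "cmod \<alpha> \<le> artanh (cmod \<alpha>)" using \<alpha>(1) by (intro artanh_ge_self) auto
  have "(\<lambda>\<zeta>. \<phi> \<zeta> $ i) holomorphic_on ball 0 R" for i
    using \<phi> R unfolding holomorphic_disc_def
    by (intro holomorphic_on_subset[of "\<lambda>\<zeta>. \<phi> \<zeta> $ i" "ball 0 1" "ball 0 R"]) auto
  then have "kobayashi (G - K) (\<phi> 0) (\<phi> \<alpha>) \<le> artanh (cmod \<alpha> / R)"
    by (intro kobayashi_scaled_disc_le[OF \<Omega> R0 \<alpha>R] avoid)
  also have "\<dots> \<le> artanh (cmod \<alpha>) + 4 / 3 * (cmod \<alpha> / R - cmod \<alpha>)"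
  proof (rule artanh_scaled_le)
    show "cmod \<alpha> / R \<le> 1 / 2" unfolding pos_divide_le_eq[OF R0] using R \<alpha>(2) by linarith
  qed (use R R0 in auto)
  also have "cmod \<alpha> / R - cmod \<alpha> = cmod \<alpha> * ((1 - R) / R)"
    using R0 by (simp add: field_simps)
  also have "cmod \<alpha> * ((1 - R) / R) \<le> artanh (cmod \<alpha>) * (2 * exp (- 2 * \<rho>) / tanh \<rho>0)"
    using s artanh_real_nonneg[OF norm_ge_zero \<alpha>(1)] R R0 one_minus_tanh_le[of \<rho>] by (intro mult_mono frac_le) (auto simp: R_def)
  finally show "kobayashi (G - K) (\<phi> 0) (\<phi> \<alpha>)
       \<le> artanh (cmod \<alpha>) * (1 + 8 / (3 * tanh \<rho>0) * exp (- 2 * \<rho>))"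
    by (simp add: algebra_simps)
qed

text \<open>
  An almost shortest chain in \<open>G\<close> may run through \<open>K\<close>, where the distance of the complement makes
  no sense. Therefore the estimate is made for the pseudodistance \<open>d\<close> on \<open>G\<close> obtained by
  collapsing the part of \<open>G\<close> near \<open>K\<close> to a point. As that part outside \<open>K\<close> has bounded
  diameter, \<open>d\<close> differs from the distance of the complement by a constant.
\<close>

lemma kobayashi_complement_le:
  fixes G K W :: "(complex ^ 'n) set"
  assumes G: "is_domain G" "bounded G" and \<Omega>: "is_domain (G - K)"
    and K: "compact K" "K \<subseteq> G" "o' \<in> K"
    and W: "open W" "K \<subseteq> W" and v: "v \<in> G - K"
    and M: "\<And>z. z \<in> W \<inter> (G - K) \<Longrightarrow> kobayashi (G - K) v z \<le> M"
  shows "\<exists>C\<ge>0. \<forall>x\<in>G - K. \<forall>y\<in>G - K. kobayashi (G - K) x y \<le> kobayashi G x y + C"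
proof -
  let ?k = "kobayashi (G - K)"
  note kG = pseudodistance_kobayashi[OF G(1)] and k = pseudodistance_kobayashi[OF \<Omega>]
  have o: "o' \<in> G" using K by blast
  obtain \<eta> where \<eta>: "0 < \<eta>" "(\<Union>x\<in>K. ball x (2 * \<eta>)) \<subseteq> W"
  proof -
    obtain e where "0 < e" "(\<Union>x\<in>K. ball x e) \<subseteq> W"
      using compact_subset_open_imp_ball_epsilon_subset[OF K(1) W] .
    then show ?thesis using that[of "e / 2"] by simp
  qed
  obtain C0 where C0: "0 < C0"
    "\<And>z w. z \<in> G \<Longrightarrow> w \<in> G \<Longrightarrow> norm (w - z) \<le> C0 * kobayashi G z w"
    using norm_le_kobayashi[OF G] by blast
  obtain M0 where M0: "\<And>x. x \<in> K \<Longrightarrow> kobayashi G o' x \<le> M0"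
    using kobayashi_bounded_on_compact[OF G(1) o K(1,2)] by blast
  define \<rho>0 where "\<rho>0 = \<eta> / C0"
  have \<rho>0: "0 < \<rho>0" using \<eta> C0 by (simp add: \<rho>0_def)
  \<comment> \<open>\<open>C0\<close> times a step is at most \<open>\<eta>\<close>, so a step that starts near \<open>K\<close> ends in \<open>W\<close>\<close>
  define \<epsilon> where "\<epsilon> = min 1 (min \<rho>0 (tanh \<rho>0 / 2))"
  have \<epsilon>: "0 < \<epsilon>" "\<epsilon> \<le> 1" "\<epsilon> \<le> \<rho>0" "\<epsilon> \<le> tanh \<rho>0 / 2" using \<rho>0 by (auto simp: \<epsilon>_def)
  define N where "N = max 0 M"
  \<comment> \<open>a 1-Lipschitz lower bound, up to \<open>N\<close>, for the distance from \<open>v\<close> that vanishes on the collar\<close>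
  define f where "f x = max 0 (?k v x - N)" for x
  define \<pi> where "\<pi> x = (if x \<in> K then v else x)" for x
  define d where "d x y = min (?k (\<pi> x) (\<pi> y)) (f (\<pi> x) + f (\<pi> y))" for x y
  have \<pi>: "\<pi> x \<in> G - K" if "x \<in> G" for x using that v by (simp add: \<pi>_def)
  have d: "pseudodistance_on G d"
    unfolding d_def
  proof (rule pseudodistance_collapse[OF k \<pi>])
    show "f x \<le> f y + ?k x y" if "x \<in> G - K" "y \<in> G - K" for x y
      using pseudodistance_onD(4)[OF k v that(2,1)] pseudodistance_onD(3)[OF k that]
        pseudodistance_onD(1)[OF k that] by (auto simp: f_def)
  qed (auto simp: f_def)
  have f0: "f (\<pi> x) = 0" if "x \<in> G" "x \<in> W" for x
    using that M[of x] pseudodistance_onD(2)[OF k v] by (auto simp: f_def \<pi>_def N_def)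
  have d0: "d x y = 0" if "x \<in> G \<inter> W" "y \<in> G \<inter> W" for x y
    using that pseudodistance_onD(1)[OF k \<pi> \<pi>] f0 by (simp add: d_def)
  define C where "C = 8 / (3 * tanh \<rho>0) * exp (2 * M0)"
  have C: "0 \<le> C" using \<rho>0 by (simp add: C_def)
  have step: "d p q \<le> s * (1 + C * exp (- 2 * kobayashi G p o'))"
    if pq: "disc_link G \<epsilon> p q s" for p q s
  proof -
    obtain \<phi> \<alpha> where \<phi>: "holomorphic_disc G \<phi>" and \<alpha>: "cmod \<alpha> < 1" "\<phi> 0 = p" "\<phi> \<alpha> = q"
      "s = artanh (cmod \<alpha>)" "s \<le> \<epsilon>"
      using pq by (auto simp: disc_link_def)
    have s: "0 \<le> s" "cmod \<alpha> \<le> s"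
      using \<alpha> artanh_ge_self[of "cmod \<alpha>"] by (auto simp: artanh_real_nonneg)
    have pqG: "p \<in> G" "q \<in> G" using disc_link_mem[OF pq] by auto
    have kpq: "kobayashi G p q \<le> s" using kobayashi_disc_le[OF G(1) \<phi> \<alpha>(1)] \<alpha> by simp
    show ?thesis
    proof (cases "\<exists>x\<in>K. dist x p < \<eta>")
      case True
      then obtain x where x: "x \<in> K" "dist x p < \<eta>" by blast
      have "C0 * kobayashi G p q \<le> C0 * \<rho>0"
        using kpq \<alpha>(5) \<epsilon>(3) C0(1) by (intro mult_left_mono) auto
      then have "dist p q \<le> \<eta>"
        using C0(2)[OF pqG] C0(1) by (simp add: \<rho>0_def dist_norm norm_minus_commute)
      then have "dist x q < 2 * \<eta>" using x(2) dist_triangle[of x q p] by linarith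
      then have "p \<in> ball x (2 * \<eta>)" "q \<in> ball x (2 * \<eta>)" using x(2) \<eta>(1) by simp_all
      then have "p \<in> W" "q \<in> W" using x(1) \<eta>(2) by blast+
      then show ?thesis using d0 pqG s C by simp
    next
      case False
      \<comment> \<open>a lower bound for the distance of \<open>p\<close> from \<open>K\<close> that is expressed by the base point\<close>
      define \<rho> where "\<rho> = max \<rho>0 (kobayashi G p o' - M0)"
      have far: "\<rho> \<le> kobayashi G (\<phi> 0) x" if x: "x \<in> K" for x
      proof -
        have xG: "x \<in> G" using x K(2) by blast
        have "\<eta> \<le> norm (x - p)" using False x by (force simp: dist_norm)
        also have "\<dots> \<le> C0 * kobayashi G p x" by (rule C0(2)[OF pqG(1) xG])
        finally have "\<rho>0 \<le> kobayashi G p x" using C0(1) by (simp add: \<rho>0_def field_simps)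
        moreover have "kobayashi G p o' \<le> kobayashi G p x + kobayashi G o' x"
          using pseudodistance_onD(4)[OF kG pqG(1) xG o] pseudodistance_onD(3)[OF kG xG o] by simp
        ultimately show ?thesis using M0[OF x] by (simp add: \<rho>_def \<alpha>(2))
      qed
      have \<rho>: "\<rho>0 \<le> \<rho>" "kobayashi G p o' - M0 \<le> \<rho>" by (auto simp: \<rho>_def)
      have "cmod \<alpha> \<le> tanh \<rho>0 / 2" using s(2) \<alpha>(5) \<epsilon>(4) by linarith
      note le = kobayashi_complement_link_le[OF G(1) \<Omega> \<phi> \<rho>0 \<rho>(1) far \<alpha>(1) this]
      have "d p q \<le> ?k p q" using le(1,2) \<alpha>(2,3) by (simp add: d_def \<pi>_def)
      also have "\<dots> \<le> s * (1 + 8 / (3 * tanh \<rho>0) * exp (- 2 * \<rho>))"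
        using le(3) \<alpha>(2-4) by simp
      also have "\<dots> \<le> s * (1 + 8 / (3 * tanh \<rho>0) * exp (2 * M0 + - 2 * kobayashi G p o'))"
        using s(1) \<rho>(2) \<rho>0 by (intro mult_left_mono add_left_mono) auto
      finally show ?thesis unfolding exp_add by (simp add: C_def mult.assoc)
    qed
  qed
  have main: "?k x y \<le> kobayashi G x y + (1 + 6 * pi * exp 1 * C + 2 * N)"
    if x: "x \<in> G - K" and y: "y \<in> G - K" for x y
  proof -
    obtain L where L: "disc_chain G \<epsilon> x y L" "L < kobayashi G x y + 1"
      using disc_chain_almost_kobayashi[OF G(1) \<epsilon>(1) zero_less_one] x y by blast
    obtain m p s where ps: "p 0 = x" "p m = y" "\<And>i. i < m \<Longrightarrow> disc_link G \<epsilon> (p i) (p (Suc i)) (s i)"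
      "\<And>i. i \<le> m \<Longrightarrow> p i \<in> G" "(\<Sum>i<m. s i) = L"
      using disc_chain_sequence[OF L(1)] by metis
    have link: "0 \<le> s i \<and> s i \<le> 1 \<and> kobayashi G (p i) (p (Suc i)) \<le> s i" if "i < m" for i
      using disc_link_nonneg[OF ps(3)[OF that]] ps(3)[OF that] \<epsilon>(2) kobayashi_disc_le[OF G(1)]
      unfolding disc_link_def by fastforce
    have "d (p 0) (p m) \<le> kobayashi G (p 0) (p m) + 1 + 6 * pi * exp 1 * C"
    proof (rule pseudodistance_le_along_almost_geodesic[OF kG d o C ps(4)])
      show "(\<Sum>i<m. s i) \<le> kobayashi G (p 0) (p m) + 1" using L(2) ps by simp
    qed (use link step ps(3) in auto)
    moreover have "?k x y \<le> d x y + 2 * N"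
      using pseudodistance_onD(4)[OF k x v y] pseudodistance_onD(3)[OF k x v] x y
      by (auto simp: d_def \<pi>_def f_def min_def max_def N_def)
    ultimately show ?thesis using ps by simp
  qed
  have "0 \<le> 1 + 6 * pi * exp 1 * C + 2 * N" using C by (simp add: N_def)
  then show ?thesis using main by blast
qed

section \<open>Discs outside a domain with a positive Levi eigenvalue\<close>

text \<open>
  Uniform second-order Taylor estimate: the expansion is centred at an arbitrary \<open>z\<close> near \<open>b\<close>, but
  uses the second derivative at \<open>b\<close>. Its continuity at \<open>b\<close> makes \<open>r'\<close> strictly differentiable
  there, and the mean value theorem along the segment from \<open>z\<close> to \<open>z + h\<close> does the rest.
\<close>

lemma C2_taylor_bound:
  fixes r :: "'a::real_normed_vector \<Rightarrow> real" and r' :: "'a \<Rightarrow> 'a \<Rightarrow>\<^sub>L real"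
  assumes U: "open U" "b \<in> U"
    and r: "\<And>x. x \<in> U \<Longrightarrow> (r has_derivative blinfun_apply (r' x)) (at x)"
    and r': "\<And>x. x \<in> U \<Longrightarrow> (r' has_derivative blinfun_apply (r'' x)) (at x)"
    and cont: "continuous_on U r''" and \<epsilon>: "0 < \<epsilon>"
  shows "\<exists>\<delta>>0. ball b \<delta> \<subseteq> U \<and> (\<forall>z h. z \<in> ball b \<delta> \<longrightarrow> z + h \<in> ball b \<delta> \<longrightarrow>
     r z + r' z h + r'' b h h / 2 - \<epsilon> * (norm h)\<^sup>2 \<le> r (z + h))"
proof -
  have "continuous (at b) r''" using cont U continuous_on_eq_continuous_at by blast
  then obtain \<delta>1 where \<delta>1: "0 < \<delta>1" "\<And>x. dist x b < \<delta>1 \<Longrightarrow> dist (r'' x) (r'' b) < \<epsilon>"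
    using \<epsilon> unfolding continuous_at_eps_delta dist_norm by blast
  obtain \<delta>2 where \<delta>2: "0 < \<delta>2" "ball b \<delta>2 \<subseteq> U" using U open_contains_ball by blast
  define \<delta> where "\<delta> = min \<delta>1 \<delta>2"
  have \<delta>: "0 < \<delta>" "ball b \<delta> \<subseteq> U" using \<delta>1 \<delta>2 by (auto simp: \<delta>_def)
  have "r z + r' z h + r'' b h h / 2 - \<epsilon> * (norm h)\<^sup>2 \<le> r (z + h)"
    if z: "z \<in> ball b \<delta>" and zh: "z + h \<in> ball b \<delta>" for z h
  proof -
    have seg: "z + t *\<^sub>R h \<in> ball b \<delta>" if "t \<in> {0..1}" for t
    proof -
      have "(1 - t) *\<^sub>R z + t *\<^sub>R (z + h) \<in> ball b \<delta>"
        using convexD[OF convex_ball z zh, of "1 - t" t] that by auto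
      then show ?thesis by (simp add: algebra_simps)
    qed
    have first: "norm (r' (z + t *\<^sub>R h) - r' z - r'' b (t *\<^sub>R h)) \<le> norm (t *\<^sub>R h) * \<epsilon>"
      if t: "t \<in> {0..1}" for t
    proof -
      have "norm (r' (z + t *\<^sub>R h) - r' z - blinfun_apply (r'' b) (z + t *\<^sub>R h - z))
          \<le> norm (z + t *\<^sub>R h - z) * \<epsilon>"
      proof (rule differentiable_bound_linearization[where S = "ball b \<delta>"])
        show "z + s *\<^sub>R (z + t *\<^sub>R h - z) \<in> ball b \<delta>" if "s \<in> {0..1}" for s
          using seg[of "s * t"] that t by (simp add: mult_le_one)
        show "(r' has_derivative blinfun_apply (r'' x)) (at x within ball b \<delta>)" if "x \<in> ball b \<delta>" for x
          using r' \<delta>(2) that by (blast intro: has_derivative_at_withinI)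
        show "onorm (blinfun_apply (r'' x) - blinfun_apply (r'' b)) \<le> \<epsilon>" if "x \<in> ball b \<delta>" for x
        proof -
          have "norm (r'' x - r'' b) < \<epsilon>"
            using \<delta>1(2)[of x] that by (simp add: \<delta>_def dist_commute dist_norm norm_minus_commute)
          then show ?thesis
            by (simp add: norm_blinfun.rep_eq minus_blinfun.rep_eq fun_diff_def)
        qed
        show "b \<in> ball b \<delta>" using \<delta>(1) by simp
      qed
      then show ?thesis by simp
    qed
    \<comment> \<open>the expected Taylor polynomial in \<open>t\<close>, without its constant term, is subtracted\<close>
    define g where "g t = r (z + t *\<^sub>R h) - t * r' z h - t\<^sup>2 * (r'' b h h / 2)" for t
    have "\<exists>t\<in>{0<..<1}. g 1 - g 0 = (r' (z + t *\<^sub>R h) - r' z - r'' b (t *\<^sub>R h)) h * (1 - 0)"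
    proof (rule mvt_simple)
      fix t :: real assume t: "0 \<le> t" "t \<le> 1"
      have "((\<lambda>t. r (z + t *\<^sub>R h)) has_derivative (\<lambda>s. r' (z + t *\<^sub>R h) (s *\<^sub>R h))) (at t within {0..1})"
      proof (rule has_derivative_compose[where g = r])
        show "((\<lambda>t. z + t *\<^sub>R h) has_derivative (\<lambda>s. s *\<^sub>R h)) (at t within {0..1})"
          by (auto intro!: derivative_eq_intros)
        show "(r has_derivative blinfun_apply (r' (z + t *\<^sub>R h))) (at (z + t *\<^sub>R h))"
          using seg[of t] t \<delta>(2) by (intro r) auto
      qed
      then have "(g has_derivative (\<lambda>s. r' (z + t *\<^sub>R h) (s *\<^sub>R h) - s * r' z h - 2 * t * s * (r'' b h h / 2)))
          (at t within {0..1})"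
        unfolding g_def by (auto intro!: derivative_eq_intros simp: algebra_simps)
      then show "(g has_derivative (\<lambda>s. (r' (z + t *\<^sub>R h) - r' z - r'' b (t *\<^sub>R h)) h * s)) (at t within {0..1})"
        by (rule has_derivative_eq_rhs)
          (auto simp: blinfun.bilinear_simps algebra_simps)
    qed simp
    then obtain t where t: "0 < t" "t < 1"
      "g 1 - g 0 = (r' (z + t *\<^sub>R h) - r' z - r'' b (t *\<^sub>R h)) h" by auto
    have "\<bar>(r' (z + t *\<^sub>R h) - r' z - r'' b (t *\<^sub>R h)) h\<bar>
        \<le> norm (r' (z + t *\<^sub>R h) - r' z - r'' b (t *\<^sub>R h)) * norm h"
      using norm_blinfun by (metis real_norm_def)
    also have "\<dots> \<le> (norm (t *\<^sub>R h) * \<epsilon>) * norm h"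
      using first[of t] t by (intro mult_right_mono) auto
    also have "\<dots> \<le> \<epsilon> * (norm h)\<^sup>2"
      using t \<epsilon> by (simp add: power2_eq_square mult_left_le_one_le mult.assoc mult.left_commute)
    finally show ?thesis using t(3) by (simp add: g_def)
  qed
  then show ?thesis using \<delta> by blast
qed

lemma vec_complex_axis_expansion:
  fixes X :: "complex ^ 'n"
  shows "X = (\<Sum>j\<in>UNIV. Re (X $ j) *\<^sub>R axis j 1 + Im (X $ j) *\<^sub>R axis j \<i>)"
proof -
  have "(\<Sum>j\<in>UNIV. Re (X $ j) *\<^sub>R axis j 1 + Im (X $ j) *\<^sub>R axis j \<i>) $ i = X $ i" for i
  proof -
    have "(\<Sum>j\<in>UNIV. Re (X $ j) *\<^sub>R axis j 1 + Im (X $ j) *\<^sub>R axis j \<i>) $ i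
        = (\<Sum>j\<in>UNIV. if j = i then X $ j else 0)"
      unfolding sum_component by (intro sum.cong) (auto simp: axis_def complex_eq_iff)
    then show ?thesis by simp
  qed
  then show ?thesis by (simp add: vec_eq_iff)
qed

lemma blinfun_complex_expansion:
  fixes L :: "(complex ^ 'n) \<Rightarrow>\<^sub>L 'b::real_normed_vector"
  shows "L X = (\<Sum>j\<in>UNIV. Re (X $ j) *\<^sub>R L (axis j 1) + Im (X $ j) *\<^sub>R L (axis j \<i>))"
  by (subst vec_complex_axis_expansion[of X]) (simp add: blinfun.bilinear_simps blinfun.sum_right)

lemma blinfun_smult: 
  fixes L :: "(complex ^ 'n) \<Rightarrow>\<^sub>L 'b::real_normed_vector"
  shows "L (\<zeta> *s v) = Re \<zeta> *\<^sub>R L v + Im \<zeta> *\<^sub>R L (\<i> *s v)"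
proof -
  have "\<zeta> *s v = Re \<zeta> *\<^sub>R v + Im \<zeta> *\<^sub>R (\<i> *s v)"
    by (simp add: vec_eq_iff complex_eq_iff)
  then show ?thesis by (simp add: blinfun.bilinear_simps)
qed

text \<open>
  Twice the complex-linear part of a real-linear functional, that is \<open>2 \<partial>r\<close> if \<open>L\<close> is the
  derivative of \<open>r\<close>.
\<close>

definition complex_derivative :: "((complex ^ 'n) \<Rightarrow>\<^sub>L real) \<Rightarrow> complex ^ 'n \<Rightarrow> complex" where
  "complex_derivative L v = Complex (L v) (- L (\<i> *s v))"

lemma complex_derivative_add:
  fixes L :: "(complex ^ 'n) \<Rightarrow>\<^sub>L real"
  shows
  "complex_derivative L (v + w) = complex_derivative L v + complex_derivative L w"
  by (simp add: complex_derivative_def blinfun.bilinear_simps vector_add_ldistrib complex_eq_iff)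

lemma complex_derivative_smult:
  fixes L :: "(complex ^ 'n) \<Rightarrow>\<^sub>L real"
  shows "complex_derivative L (\<zeta> *s v) = \<zeta> * complex_derivative L v"
proof -
  have "\<i> *s (\<zeta> *s v) = (\<i> * \<zeta>) *s v" by (simp add: vector_smult_assoc)
  then show ?thesis
    by (simp add: complex_derivative_def complex_eq_iff blinfun_smult[of L \<zeta>] blinfun_smult[of L "\<i> * \<zeta>"])
qed

lemma blinfun_eq_Re_complex_derivative:
  fixes L :: "(complex ^ 'n) \<Rightarrow>\<^sub>L real"
  shows "L v = Re (complex_derivative L v)"
  by (simp add: complex_derivative_def)


lemma complex_derivative_coordinates:
  fixes L :: "(complex ^ 'n) \<Rightarrow>\<^sub>L real"
  shows "complex_derivative L X
    = (\<Sum>j\<in>UNIV. (complex_of_real (L (axis j 1)) - \<i> * complex_of_real (L (axis j \<i>))) * X $ j)"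
proof -
  have sum: "complex_derivative L (sum f I) = (\<Sum>j\<in>I. complex_derivative L (f j))" for f :: "'n \<Rightarrow> complex ^ 'n" and I
    by (induction I rule: infinite_finite_induct)
      (simp_all add: complex_derivative_add, simp_all add: complex_derivative_def complex_eq_iff)
  have e: "complex_derivative L (axis j 1) = complex_of_real (L (axis j 1)) - \<i> * complex_of_real (L (axis j \<i>))" for j
  proof -
    have "\<i> *s axis j (1::complex) = axis j \<i>" by (simp add: vec_eq_iff axis_def)
    then show ?thesis by (simp add: complex_derivative_def complex_eq_iff)
  qed
  have "complex_derivative L X = complex_derivative L (\<Sum>j\<in>UNIV. X $ j *s axis j 1)"
    by (simp add: basis_expansion)
  then show ?thesis by (simp add: sum complex_derivative_smult e mult.commute)
qed

lemma frechet_derivative_of_real: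
  assumes "(r has_derivative D) (at z)"
  shows "frechet_derivative (\<lambda>z. complex_of_real (r z)) (at z) = (\<lambda>v. complex_of_real (D v))"
  by (rule frechet_derivative_at[symmetric])
    (rule bounded_linear.has_derivative[OF bounded_linear_of_real assms])

lemma complex_tangent_space_derivative:
  fixes L :: "(complex ^ 'n) \<Rightarrow>\<^sub>L real"
  assumes "(r has_derivative blinfun_apply L) (at b)" "X \<in> complex_tangent_space r b"
  shows "complex_derivative L X = 0"
proof -
  have "complex_derivative L X = 2 * (\<Sum>j\<in>UNIV. wirtinger j (\<lambda>z. complex_of_real (r z)) b * X $ j)"
    unfolding complex_derivative_coordinates wirtinger_def frechet_derivative_of_real[OF assms(1)]
    by (simp add: sum_distrib_left)
  then show ?thesis using assms(2) by (simp add: complex_tangent_space_def)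
qed

text \<open>
  Expands the Hermitian form in the real basis \<open>axis j 1\<close>, \<open>axis j \<i>\<close>. It expresses the Levi
  form by the real second derivative, for which the Taylor estimate is available.
\<close>

lemma Re_complex_hessian:
  fixes r' :: "complex ^ 'n \<Rightarrow> (complex ^ 'n) \<Rightarrow>\<^sub>L real"
  assumes U: "open U" "b \<in> U"
    and r: "\<And>x. x \<in> U \<Longrightarrow> (r has_derivative blinfun_apply (r' x)) (at x)"
    and r': "(r' has_derivative blinfun_apply B) (at b)"
  shows "Re (complex_hessian r b X X) = (B X X + B (\<i> *s X) (\<i> *s X)) / 4"
proof -
  define f where "f = (\<lambda>z. complex_of_real (r z))"
  have bar: "wirtinger_bar k f z
      = (complex_of_real (r' z (axis k 1)) + \<i> * complex_of_real (r' z (axis k \<i>))) / 2"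
    if "z \<in> U" for k z
    unfolding wirtinger_bar_def f_def frechet_derivative_of_real[OF r[OF that]] by simp
  have comp: "((\<lambda>z. r' z v) has_derivative (\<lambda>u. B u v)) (at b)" for v
    using bounded_linear.has_derivative[OF blinfun.bounded_linear_left r'] .
  have "((\<lambda>z. (complex_of_real (r' z (axis k 1)) + \<i> * complex_of_real (r' z (axis k \<i>))) / 2)
      has_derivative (\<lambda>u. (complex_of_real (B u (axis k 1)) + \<i> * complex_of_real (B u (axis k \<i>))) / 2)) (at b)" for k
    by (intro derivative_intros bounded_linear.has_derivative[OF bounded_linear_of_real] comp
        has_derivative_mult_right bounded_linear.has_derivative[OF bounded_linear_divide])
  then have "(wirtinger_bar k f has_derivative
      (\<lambda>u. (complex_of_real (B u (axis k 1)) + \<i> * complex_of_real (B u (axis k \<i>))) / 2)) (at b)" for k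
    by (rule has_derivative_transform_within_open[OF _ U]) (simp add: bar)
  then have "frechet_derivative (wirtinger_bar k f) (at b) =
      (\<lambda>u. (complex_of_real (B u (axis k 1)) + \<i> * complex_of_real (B u (axis k \<i>))) / 2)" for k
    by (rule frechet_derivative_at[symmetric])
  then have second: "wirtinger j (wirtinger_bar k f) b =
      (complex_of_real (B (axis j 1) (axis k 1)) + \<i> * complex_of_real (B (axis j 1) (axis k \<i>))
        - \<i> * (complex_of_real (B (axis j \<i>) (axis k 1)) + \<i> * complex_of_real (B (axis j \<i>) (axis k \<i>)))) / 4" for j k
    unfolding wirtinger_def by (simp add: field_simps)
  have expand: "B Y Y = (\<Sum>j\<in>UNIV. \<Sum>k\<in>UNIV.
      Re (Y $ j) * Re (Y $ k) * B (axis j 1) (axis k 1) + Re (Y $ j) * Im (Y $ k) * B (axis j 1) (axis k \<i>)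
      + Im (Y $ j) * Re (Y $ k) * B (axis j \<i>) (axis k 1) + Im (Y $ j) * Im (Y $ k) * B (axis j \<i>) (axis k \<i>))" for Y
  proof -
    have "B Y Y = (\<Sum>j\<in>UNIV. Re (Y $ j) * B (axis j 1) Y + Im (Y $ j) * B (axis j \<i>) Y)"
      by (subst blinfun_complex_expansion[of B Y])
        (simp add: blinfun.sum_left blinfun.add_left blinfun.scaleR_left)
    also have "\<dots> = (\<Sum>j\<in>UNIV. \<Sum>k\<in>UNIV.
      Re (Y $ j) * Re (Y $ k) * B (axis j 1) (axis k 1) + Re (Y $ j) * Im (Y $ k) * B (axis j 1) (axis k \<i>)
      + Im (Y $ j) * Re (Y $ k) * B (axis j \<i>) (axis k 1) + Im (Y $ j) * Im (Y $ k) * B (axis j \<i>) (axis k \<i>))"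
      unfolding blinfun_complex_expansion[of "B (axis j 1)" Y for j] blinfun_complex_expansion[of "B (axis j \<i>)" Y for j]
      by (simp add: sum_distrib_left sum.distrib[symmetric] algebra_simps)
    finally show ?thesis .
  qed
  have "4 * Re (complex_hessian r b X X) = (\<Sum>j\<in>UNIV. \<Sum>k\<in>UNIV. 4 * Re (wirtinger j (wirtinger_bar k f) b * X $ j * cnj (X $ k)))"
    unfolding complex_hessian_def f_def by (simp add: sum_distrib_left)
  also have "\<dots> = B X X + B (\<i> *s X) (\<i> *s X)"
    unfolding expand[of X] expand[of "\<i> *s X"] second sum.distrib[symmetric]
    by (intro sum.cong refl) (simp add: field_simps)
  finally show ?thesis by simp
qed


text \<open>
  On a complex line a real quadratic form is the sum of a multiple of \<open>\<bar>\<zeta>\<bar>\<^sup>2\<close> and a harmonic part.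
  The multiple is the Levi form. The harmonic part is the real part of a holomorphic function and can
  be cancelled by bending the disc.
\<close>

lemma quadratic_on_complex_line:
  fixes B :: "(complex ^ 'n) \<Rightarrow>\<^sub>L (complex ^ 'n) \<Rightarrow>\<^sub>L real"
  shows "\<exists>e. \<forall>\<zeta>. B (\<zeta> *s X) (\<zeta> *s X) / 2
    = (B X X + B (\<i> *s X) (\<i> *s X)) / 4 * (cmod \<zeta>)\<^sup>2 + Re (e * \<zeta>\<^sup>2)"
proof (intro exI allI)
  fix \<zeta> :: complex
  show "B (\<zeta> *s X) (\<zeta> *s X) / 2 = (B X X + B (\<i> *s X) (\<i> *s X)) / 4 * (cmod \<zeta>)\<^sup>2
      + Re (Complex ((B X X - B (\<i> *s X) (\<i> *s X)) / 4) (- (B X (\<i> *s X) + B (\<i> *s X) X) / 4) * \<zeta>\<^sup>2)"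
    unfolding cmod_power2 blinfun_smult[of B \<zeta>] blinfun_smult[of _ \<zeta> X]
    by (simp add: blinfun.bilinear_simps blinfun_smult[of _ \<zeta> X] power2_eq_square field_simps)
qed

text \<open>
  The disc is \<open>z + \<zeta> Y + \<zeta>\<^sup>2 w\<close>, where \<open>Y\<close> differs from \<open>X\<close> by a multiple of \<open>\<nu>\<close> that makes it
  complex tangent to the level set of \<open>r\<close> through \<open>z\<close>, and \<open>w\<close> is the multiple of \<open>\<nu>\<close> that
  cancels the harmonic part of the second-order term along \<open>X\<close>. What remains of the Taylor polynomial
  is \<open>r z + a \<bar>\<zeta>\<bar>\<^sup>2\<close> with the Levi form \<open>a\<close> of \<open>X\<close>. For \<open>z\<close> close to \<open>b\<close> the corrections and the
  Taylor remainder use up at most half of \<open>a\<close>.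
\<close>

lemma exterior_disc:
  fixes r :: "complex ^ 'n \<Rightarrow> real" and r' :: "complex ^ 'n \<Rightarrow> (complex ^ 'n) \<Rightarrow>\<^sub>L real"
  assumes U: "open U" "b \<in> U"
    and r: "\<And>x. x \<in> U \<Longrightarrow> (r has_derivative blinfun_apply (r' x)) (at x)"
    and r': "\<And>x. x \<in> U \<Longrightarrow> (r' has_derivative blinfun_apply (r'' x)) (at x)"
    and cont: "continuous_on U r''"
    and \<nu>: "complex_derivative (r' b) \<nu> \<noteq> 0"
    and X: "X \<noteq> 0" "complex_derivative (r' b) X = 0"
    and A: "0 < r'' b X X + r'' b (\<i> *s X) (\<i> *s X)" and \<rho>: "0 < \<rho>"
  shows "\<exists>\<eta>>0. \<exists>\<delta>>0. \<exists>c>0. \<exists>m>0. \<forall>z\<in>ball b \<eta>. \<exists>Y w. m \<le> norm Y \<and>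
    (\<forall>\<zeta>. cmod \<zeta> \<le> \<delta> \<longrightarrow> z + \<zeta> *s Y + \<zeta>\<^sup>2 *s w \<in> ball b \<rho> \<inter> U \<and>
       r z + c * (cmod \<zeta>)\<^sup>2 \<le> r (z + \<zeta> *s Y + \<zeta>\<^sup>2 *s w))"
proof -
  define a where "a = (r'' b X X + r'' b (\<i> *s X) (\<i> *s X)) / 4"
  have a: "0 < a" using A by (simp add: a_def)
  obtain e where e: "\<And>\<zeta>. r'' b (\<zeta> *s X) (\<zeta> *s X) / 2 = a * (cmod \<zeta>)\<^sup>2 + Re (e * \<zeta>\<^sup>2)"
    using quadratic_on_complex_line[of "r'' b" X] unfolding a_def by blast
  define n where "n = norm X"
  have n: "0 < n" using X by (simp add: n_def)
  define K where "K = norm (r'' b)"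
  have K: "0 \<le> K" by (simp add: K_def)
  \<comment> \<open>\<open>\<kappa>\<close> bounds the deviation of the disc from \<open>\<zeta> X\<close>, relative to \<open>\<bar>\<zeta>\<bar>\<close>\<close>
  define \<kappa> where "\<kappa> = min 1 (min (n / 2) (a / (4 * (K + 1) * (n + 1))))"
  have \<kappa>: "0 < \<kappa>" "\<kappa> \<le> 1" "\<kappa> \<le> n / 2" "\<kappa> \<le> a / (4 * (K + 1) * (n + 1))"
    unfolding \<kappa>_def using a n K by (simp, (meson min.cobounded1 min.cobounded2 order.trans)+)
  have "0 < 4 * (K + 1) * (n + 1)" using K n by simp
  then have "\<kappa> * (4 * (K + 1) * (n + 1)) \<le> a" using \<kappa>(4) by (simp only: pos_le_divide_eq)
  then have K\<kappa>: "(K + 1) * (\<kappa> * (n + 1)) \<le> a / 4" by (simp add: algebra_simps)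
  define \<epsilon> where "\<epsilon> = a / (4 * (n + 1)\<^sup>2)"
  have \<epsilon>: "0 < \<epsilon>" using a n by (simp add: \<epsilon>_def)
  obtain \<delta>T where \<delta>T: "0 < \<delta>T" "ball b \<delta>T \<subseteq> U"
    and taylor: "\<And>z h. z \<in> ball b \<delta>T \<Longrightarrow> z + h \<in> ball b \<delta>T \<Longrightarrow>
      r z + r' z h + r'' b h h / 2 - \<epsilon> * (norm h)\<^sup>2 \<le> r (z + h)"
    using C2_taylor_bound[OF U r r' cont \<epsilon>] by blast
  define R where "R = min \<rho> \<delta>T"
  have R: "0 < R" "R \<le> \<rho>" "R \<le> \<delta>T" using \<rho> \<delta>T by (auto simp: R_def)
  define p where "p z v = complex_derivative (r' z) v" for z v
  have p_tendsto: "((\<lambda>z. p z v) \<longlongrightarrow> p b v) (at b)" for v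
  proof -
    have "(r' \<longlongrightarrow> r' b) (at b)"
      using has_derivative_continuous[OF r'[OF U(2)]] by (simp add: continuous_at)
    then show ?thesis
      unfolding p_def complex_derivative_def by (intro tendsto_Complex tendsto_intros)
  qed
  \<comment> \<open>\<open>\<tau>\<close> corrects the direction \<open>X\<close> and vanishes at \<open>b\<close>; \<open>\<mu>\<close> bends the disc\<close>
  define \<tau> where "\<tau> z = p z X / p z \<nu>" for z
  define \<mu> where "\<mu> z = e / p z \<nu>" for z
  define E where "E = norm (\<mu> b *s \<nu>)"
  have p_b: "p b \<nu> \<noteq> 0" "p b X = 0" using \<nu> X by (auto simp: p_def)
  have "((\<lambda>z. cmod (\<tau> z) * norm \<nu>) \<longlongrightarrow> cmod (p b X / p b \<nu>) * norm \<nu>) (at b)"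
    unfolding \<tau>_def using p_b(1) by (intro tendsto_intros p_tendsto)
  then have ev1: "\<forall>\<^sub>F z in at b. norm (\<tau> z *s \<nu>) < \<kappa> / 2"
    unfolding norm_complex_smult using \<kappa>(1) p_b(2) by (intro order_tendstoD) auto
  have "((\<lambda>z. cmod (\<mu> z) * norm \<nu>) \<longlongrightarrow> cmod (\<mu> b) * norm \<nu>) (at b)"
    unfolding \<mu>_def using p_b(1) by (intro tendsto_intros p_tendsto)
  then have ev2: "\<forall>\<^sub>F z in at b. norm (\<mu> z *s \<nu>) < E + 1"
    unfolding norm_complex_smult E_def by (intro order_tendstoD) auto
  have ev3: "\<forall>\<^sub>F z in at b. p z \<nu> \<noteq> 0"
    using tendsto_imp_eventually_ne[OF p_tendsto p_b(1)] .
  have "\<forall>\<^sub>F z in at b. norm (\<tau> z *s \<nu>) < \<kappa> / 2 \<and> norm (\<mu> z *s \<nu>) < E + 1 \<and> p z \<nu> \<noteq> 0"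
    using ev1 ev2 ev3 by eventually_elim simp
  then obtain \<eta>1 where \<eta>1: "0 < \<eta>1" and near: "\<And>z. dist z b < \<eta>1 \<Longrightarrow> z \<noteq> b \<Longrightarrow>
      norm (\<tau> z *s \<nu>) < \<kappa> / 2 \<and> norm (\<mu> z *s \<nu>) < E + 1 \<and> p z \<nu> \<noteq> 0"
    unfolding eventually_at by auto
  have near_b: "norm (\<tau> z *s \<nu>) < \<kappa> / 2 \<and> norm (\<mu> z *s \<nu>) < E + 1 \<and> p z \<nu> \<noteq> 0"
    if "dist z b < \<eta>1" for z
    using near[OF that] p_b \<kappa>(1) by (cases "z = b") (auto simp: \<tau>_def E_def)
  have E: "0 \<le> E" by (simp add: E_def)
  define \<delta> where "\<delta> = min (\<kappa> / (2 * (E + 1))) (R / (2 * (n + 1)))"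
  have \<delta>: "0 < \<delta>" "\<delta> \<le> \<kappa> / (2 * (E + 1))" "\<delta> \<le> R / (2 * (n + 1))"
    using \<kappa>(1) E R(1) n by (auto simp: \<delta>_def)
  define \<eta> where "\<eta> = min \<eta>1 (R / 2)"
  have \<eta>: "0 < \<eta>" "\<eta> \<le> \<eta>1" "\<eta> \<le> R / 2" using \<eta>1 R(1) by (auto simp: \<eta>_def)
  have main: "\<exists>Y w. n / 2 \<le> norm Y \<and>
    (\<forall>\<zeta>. cmod \<zeta> \<le> \<delta> \<longrightarrow> z + \<zeta> *s Y + \<zeta>\<^sup>2 *s w \<in> ball b \<rho> \<inter> U \<and>
       r z + a / 2 * (cmod \<zeta>)\<^sup>2 \<le> r (z + \<zeta> *s Y + \<zeta>\<^sup>2 *s w))" if z: "z \<in> ball b \<eta>" for z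
  proof -
    have nz: "norm (\<tau> z *s \<nu>) < \<kappa> / 2" "norm (\<mu> z *s \<nu>) < E + 1" "p z \<nu> \<noteq> 0"
      using near_b[of z] z \<eta>(2) by (auto simp: dist_commute)
    define Y where "Y = X + (- \<tau> z) *s \<nu>"
    define w where "w = (- \<mu> z) *s \<nu>"
    have "norm X \<le> norm Y + norm (\<tau> z *s \<nu>)"
      using norm_triangle_ineq[of Y "\<tau> z *s \<nu>"] by (simp add: Y_def)
    then have Y: "n / 2 \<le> norm Y" using nz(1) \<kappa>(3) n unfolding n_def[symmetric] by linarith
    have "z + \<zeta> *s Y + \<zeta>\<^sup>2 *s w \<in> ball b \<rho> \<inter> U \<and>
       r z + a / 2 * (cmod \<zeta>)\<^sup>2 \<le> r (z + \<zeta> *s Y + \<zeta>\<^sup>2 *s w)" if \<zeta>: "cmod \<zeta> \<le> \<delta>" for \<zeta>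
    proof -
      let ?t = "cmod \<zeta>"
      define h where "h = \<zeta> *s Y + \<zeta>\<^sup>2 *s w"
      define g where "g = \<zeta> *s ((- \<tau> z) *s \<nu>) + \<zeta>\<^sup>2 *s w"
      have h: "h = \<zeta> *s X + g" by (simp add: h_def g_def Y_def vector_add_ldistrib add.assoc)
      have "norm g \<le> ?t * norm (\<tau> z *s \<nu>) + ?t\<^sup>2 * norm (\<mu> z *s \<nu>)"
        unfolding g_def w_def
        by (rule order.trans[OF norm_triangle_ineq]) (simp add: norm_complex_smult norm_mult norm_power)
      also have "\<dots> \<le> ?t * (\<kappa> / 2) + ?t\<^sup>2 * (E + 1)"
        using nz by (intro add_mono mult_left_mono) auto
      also have "?t\<^sup>2 * (E + 1) \<le> ?t * (\<kappa> / 2)"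
      proof -
        have "?t * (E + 1) \<le> \<delta> * (E + 1)" using \<zeta> E by (intro mult_right_mono) auto
        also have "\<dots> \<le> \<kappa> / 2" using \<delta>(2) E by (simp add: field_simps)
        finally have "?t * (E + 1) \<le> \<kappa> / 2" .
        then have "?t * (?t * (E + 1)) \<le> ?t * (\<kappa> / 2)" by (intro mult_left_mono) auto
        then show ?thesis by (simp add: power2_eq_square mult.assoc)
      qed
      finally have g: "norm g \<le> \<kappa> * ?t" by (simp add: algebra_simps)
      have X_le: "norm (\<zeta> *s X) = n * ?t" by (simp add: norm_complex_smult n_def)
      have "norm h \<le> n * ?t + \<kappa> * ?t"
        unfolding h using norm_triangle_ineq[of "\<zeta> *s X" g] g X_le by linarith
      also have "\<dots> \<le> n * ?t + 1 * ?t" using \<kappa>(2) by (intro add_left_mono mult_right_mono) auto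
      finally have h_le: "norm h \<le> (n + 1) * ?t" by (simp add: algebra_simps)
      also have "\<dots> \<le> (n + 1) * \<delta>" using \<zeta> n by (intro mult_left_mono) auto
      also have "\<dots> \<le> R / 2" using \<delta>(3) n by (simp add: field_simps)
      finally have "dist b (z + h) < R"
        using dist_triangle[of b "z + h" z] z \<eta>(3) by (simp add: dist_norm)
      then have zh: "z + h \<in> ball b R" by simp
      have z': "z \<in> ball b \<delta>T" using z \<eta>(3) R by simp
      have "p z h = \<zeta> * (p z X + - \<tau> z * p z \<nu>) + \<zeta>\<^sup>2 * (- \<mu> z * p z \<nu>)"
        by (simp only: p_def h_def Y_def w_def complex_derivative_add complex_derivative_smult)
      also have "\<dots> = - (e * \<zeta>\<^sup>2)" using nz(3) by (simp add: \<tau>_def \<mu>_def)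
      finally have ph: "p z h = - (e * \<zeta>\<^sup>2)" .
      have bil: "\<bar>r'' b u v\<bar> \<le> K * norm u * norm v" for u v
      proof -
        have "\<bar>r'' b u v\<bar> \<le> norm (r'' b u) * norm v" using norm_blinfun by (metis real_norm_def)
        also have "\<dots> \<le> K * norm u * norm v"
          unfolding K_def by (intro mult_right_mono norm_blinfun) auto
        finally show ?thesis .
      qed
      have "r'' b h h = r'' b (\<zeta> *s X) (\<zeta> *s X) + r'' b g h + r'' b (\<zeta> *s X) g"
        by (simp add: h blinfun.bilinear_simps)
      moreover have "\<bar>r'' b g h\<bar> \<le> a / 4 * ?t\<^sup>2"
      proof -
        have "\<bar>r'' b g h\<bar> \<le> K * norm g * norm h" by (rule bil)
        also have "\<dots> \<le> K * (\<kappa> * ?t) * ((n + 1) * ?t)"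
          using g h_le K \<kappa>(1) by (intro mult_mono) auto
        also have "\<dots> = K * \<kappa> * (n + 1) * ?t\<^sup>2" by (simp add: power2_eq_square algebra_simps)
        also have "\<dots> \<le> a / 4 * ?t\<^sup>2"
        proof (rule mult_right_mono)
          have "K * (\<kappa> * (n + 1)) \<le> (K + 1) * (\<kappa> * (n + 1))"
            using \<kappa>(1) n by (intro mult_right_mono) auto
          also note K\<kappa>
          finally show "K * \<kappa> * (n + 1) \<le> a / 4" by (simp add: mult.assoc)
        qed simp
        finally show ?thesis .
      qed
      moreover have "\<bar>r'' b (\<zeta> *s X) g\<bar> \<le> a / 4 * ?t\<^sup>2"
      proof -
        have "\<bar>r'' b (\<zeta> *s X) g\<bar> \<le> K * norm (\<zeta> *s X) * norm g" by (rule bil)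
        also have "\<dots> \<le> K * (n * ?t) * (\<kappa> * ?t)"
          unfolding X_le using g K n by (intro mult_left_mono) auto
        also have "\<dots> = K * \<kappa> * n * ?t\<^sup>2" by (simp add: power2_eq_square algebra_simps)
        also have "\<dots> \<le> a / 4 * ?t\<^sup>2"
        proof (rule mult_right_mono)
          have "K * (\<kappa> * n) \<le> (K + 1) * (\<kappa> * (n + 1))"
            using \<kappa>(1) n K by (intro mult_mono) auto
          also note K\<kappa>
          finally show "K * \<kappa> * n \<le> a / 4" by (simp add: mult.assoc)
        qed simp
        finally show ?thesis .
      qed
      ultimately have "r'' b h h / 2 \<ge> a * ?t\<^sup>2 + Re (e * \<zeta>\<^sup>2) - a / 4 * ?t\<^sup>2"
        using e[of \<zeta>] by linarith
      moreover have "r' z h = - Re (e * \<zeta>\<^sup>2)"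
        using ph blinfun_eq_Re_complex_derivative[of "r' z" h] by (simp add: p_def)
      moreover have "\<epsilon> * (norm h)\<^sup>2 \<le> a / 4 * ?t\<^sup>2"
      proof -
        have "(norm h)\<^sup>2 \<le> ((n + 1) * ?t)\<^sup>2" using h_le by (intro power_mono) auto
        then have "\<epsilon> * (norm h)\<^sup>2 \<le> \<epsilon> * ((n + 1) * ?t)\<^sup>2" using \<epsilon> by (intro mult_left_mono) auto
        also have "\<dots> = a / 4 * ?t\<^sup>2" using n by (simp add: \<epsilon>_def power_mult_distrib)
        finally show ?thesis .
      qed
      moreover have "r z + r' z h + r'' b h h / 2 - \<epsilon> * (norm h)\<^sup>2 \<le> r (z + h)"
        using taylor[OF z'] zh R(3) by simp
      ultimately have "r z + a / 2 * ?t\<^sup>2 \<le> r (z + h)" by linarith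
      moreover have "z + h \<in> ball b \<rho> \<inter> U" using zh R \<delta>T(2) by (auto simp: subset_iff)
      ultimately show ?thesis by (simp add: h_def add.assoc)
    qed
    then show ?thesis using Y by blast
  qed
  show ?thesis
    using \<eta>(1) \<delta>(1) a n main
    by (intro exI[of _ \<eta>] conjI exI[of _ \<delta>] exI[of _ "a / 2"] exI[of _ "n / 2"]) auto
qed

text \<open>
  Test the eigenvector against itself.
\<close>

lemma levi_eigenvalue_direction:
  fixes r :: "complex ^ 'n \<Rightarrow> real"
  assumes "levi_eigenvalue r b \<mu>" "0 < \<mu>"
  obtains X where "X \<in> complex_tangent_space r b" "X \<noteq> 0" "0 < Re (complex_hessian r b X X)"
proof -
  obtain X where X: "X \<in> complex_tangent_space r b" "X \<noteq> 0"
    "complex_hessian r b X X = complex_of_real \<mu> * (\<Sum>j\<in>UNIV. X $ j * cnj (X $ j))"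
    using assms(1) unfolding levi_eigenvalue_def by blast
  have "Re (\<Sum>j\<in>UNIV. X $ j * cnj (X $ j)) = (\<Sum>j\<in>UNIV. (cmod (X $ j))\<^sup>2)"
    unfolding Re_sum by (intro sum.cong refl) (simp only: complex_norm_square[symmetric] Re_complex_of_real)
  moreover obtain i where "X $ i \<noteq> 0" using X(2) by (auto simp: vec_eq_iff)
  then have "0 < (\<Sum>j\<in>UNIV. (cmod (X $ j))\<^sup>2)"
    by (intro sum_pos2[of _ i]) auto
  ultimately have "0 < Re (complex_hessian r b X X)" using assms(2) by (simp add: X(3))
  then show ?thesis using X that by blast
qed

text \<open>
  Since \<open>r\<close> is nonnegative at \<open>z\<close> and grows along the disc, the punctured disc lies where \<open>r\<close> is
  positive and so avoids \<open>closure D\<close>, while the centre does so by assumption. The set \<open>K\<close> consists of points with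
  \<open>r\<close> at least the value guaranteed at half of the radius, so it does not depend on \<open>z\<close>.
\<close>

lemma exterior_discs_at_boundary:
  fixes r :: "complex ^ 'n \<Rightarrow> real"
  assumes D: "open D" and r: "C2_defining_function D r" and b: "b \<in> frontier D"
    and levi: "\<exists>\<mu>>0. levi_eigenvalue r b \<mu>" and \<rho>: "0 < \<rho>"
  shows "\<exists>\<eta>>0. \<exists>\<delta>>0. \<exists>m>0. \<exists>K. compact K \<and> K \<subseteq> ball b \<rho> - closure D \<and>
    (\<forall>z\<in>ball b \<eta> - closure D. \<exists>Y w. m \<le> norm Y \<and>
      (\<forall>\<zeta>. cmod \<zeta> \<le> \<delta> \<longrightarrow> z + \<zeta> *s Y + \<zeta>\<^sup>2 *s w \<in> ball b \<rho> - closure D) \<and>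
      (\<forall>\<zeta>. cmod \<zeta> = \<delta> / 2 \<longrightarrow> z + \<zeta> *s Y + \<zeta>\<^sup>2 *s w \<in> K))"
proof -
  obtain U where U: "open U" "closure D \<subseteq> U" "C2_on U r" "D = {x \<in> U. r x < 0}"
    and grad: "frechet_derivative r (at b) \<noteq> (\<lambda>v. 0)"
    using r b unfolding C2_defining_function_def by blast
  obtain r' :: "complex ^ 'n \<Rightarrow> (complex ^ 'n) \<Rightarrow>\<^sub>L real" and r'' where
    r': "\<And>x. x \<in> U \<Longrightarrow> (r has_derivative blinfun_apply (r' x)) (at x)"
    and r'': "\<And>x. x \<in> U \<Longrightarrow> (r' has_derivative blinfun_apply (r'' x)) (at x)"
    and cont: "continuous_on U r''"
    using U(3) unfolding C2_on_def by blast
  have bU: "b \<in> U" using b U(2) by (auto simp: frontier_def)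
  have cont_r: "continuous_on U r"
    using r' has_derivative_continuous by (blast intro: continuous_at_imp_continuous_on)
  \<comment> \<open>\<open>r\<close> may have further zeros in \<open>U\<close>; only points with positive \<open>r\<close> are certainly exterior\<close>
  have ext: "x \<notin> closure D" if x: "x \<in> U" "0 < r x" for x
  proof -
    have "open (U \<inter> r -` {0<..})"
      using continuous_open_preimage[OF cont_r U(1) open_greaterThan] .
    moreover have "(U \<inter> r -` {0<..}) \<inter> D = {}" using U(4) by auto
    ultimately have "(U \<inter> r -` {0<..}) \<inter> closure D = {}" using open_Int_closure_eq_empty by blast
    then show ?thesis using x by auto
  qed
  have "frechet_derivative r (at b) = blinfun_apply (r' b)"
    using frechet_derivative_at[OF r'[OF bU]] by simp
  then obtain \<nu> where "r' b \<nu> \<noteq> 0" using grad by auto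
  then have \<nu>: "complex_derivative (r' b) \<nu> \<noteq> 0" by (simp add: complex_derivative_def complex_eq_iff)
  obtain X where X: "X \<in> complex_tangent_space r b" "X \<noteq> 0" "0 < Re (complex_hessian r b X X)"
    using levi levi_eigenvalue_direction by blast
  have X0: "complex_derivative (r' b) X = 0"
    by (rule complex_tangent_space_derivative[OF r'[OF bU] X(1)])
  have A: "0 < r'' b X X + r'' b (\<i> *s X) (\<i> *s X)"
    using X(3) Re_complex_hessian[OF U(1) bU r' r''[OF bU], of X] by simp
  obtain e where e: "0 < e" "cball b e \<subseteq> U" using U(1) bU open_contains_cball by blast
  define \<rho>' where "\<rho>' = min e (\<rho> / 2)"
  have \<rho>': "0 < \<rho>'" "cball b \<rho>' \<subseteq> U" "cball b \<rho>' \<subseteq> ball b \<rho>"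
    using e \<rho> by (auto simp: \<rho>'_def subset_iff)
  obtain \<eta> \<delta> c m where pos: "0 < \<eta>" "0 < \<delta>" "0 < c" "0 < m"
    and disc: "\<And>z. z \<in> ball b \<eta> \<Longrightarrow> \<exists>Y w. m \<le> norm Y \<and>
    (\<forall>\<zeta>. cmod \<zeta> \<le> \<delta> \<longrightarrow> z + \<zeta> *s Y + \<zeta>\<^sup>2 *s w \<in> ball b \<rho>' \<inter> U \<and>
       r z + c * (cmod \<zeta>)\<^sup>2 \<le> r (z + \<zeta> *s Y + \<zeta>\<^sup>2 *s w))"
    using exterior_disc[OF U(1) bU r' r'' cont \<nu> X(2) X0 A \<rho>'(1)] by blast
  define K where "K = cball b \<rho>' \<inter> r -` {c * (\<delta> / 2)\<^sup>2..}"
  have K1: "compact K"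
  proof -
    have "closed K" unfolding K_def
      using continuous_closed_preimage[OF continuous_on_subset[OF cont_r \<rho>'(2)] closed_cball closed_atLeast] .
    then show ?thesis by (metis K_def bounded_Int bounded_cball compact_eq_bounded_closed)
  qed
  have K2: "K \<subseteq> ball b \<rho> - closure D"
  proof
    fix x assume x: "x \<in> K"
    have "0 < c * (\<delta> / 2)\<^sup>2" using pos by simp
    then have "0 < r x" using x by (auto simp: K_def)
    then show "x \<in> ball b \<rho> - closure D" using ext[of x] x \<rho>' by (auto simp: K_def)
  qed
  have discs: "\<exists>Y w. m \<le> norm Y \<and>
      (\<forall>\<zeta>. cmod \<zeta> \<le> \<delta> \<longrightarrow> z + \<zeta> *s Y + \<zeta>\<^sup>2 *s w \<in> ball b \<rho> - closure D) \<and>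
      (\<forall>\<zeta>. cmod \<zeta> = \<delta> / 2 \<longrightarrow> z + \<zeta> *s Y + \<zeta>\<^sup>2 *s w \<in> K)"
    if z: "z \<in> ball b \<eta> - closure D" for z
  proof -
    obtain Y w where Y: "m \<le> norm Y" and
      \<phi>: "\<And>\<zeta>. cmod \<zeta> \<le> \<delta> \<Longrightarrow> z + \<zeta> *s Y + \<zeta>\<^sup>2 *s w \<in> ball b \<rho>' \<inter> U"
      "\<And>\<zeta>. cmod \<zeta> \<le> \<delta> \<Longrightarrow> r z + c * (cmod \<zeta>)\<^sup>2 \<le> r (z + \<zeta> *s Y + \<zeta>\<^sup>2 *s w)"
      using disc z by blast
    have "z \<in> U" using \<phi>(1)[of 0] pos by simp
    moreover have "z \<notin> D" using z closure_subset by blast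
    ultimately have rz: "0 \<le> r z" using U(4) by auto
    have 1: "z + \<zeta> *s Y + \<zeta>\<^sup>2 *s w \<in> ball b \<rho> - closure D" if \<zeta>: "cmod \<zeta> \<le> \<delta>" for \<zeta>
    proof (cases "\<zeta> = 0")
      case True
      then have eq: "z + \<zeta> *s Y + \<zeta>\<^sup>2 *s w = z" by simp
      have "z \<in> cball b \<rho>'" using \<phi>(1)[of 0] pos by simp
      then have "z \<in> ball b \<rho>" by (rule subsetD[OF \<rho>'(3)])
      then show ?thesis unfolding eq using z by simp
    next
      case False
      then have "0 < c * (cmod \<zeta>)\<^sup>2" using pos by simp
      then have "0 < r (z + \<zeta> *s Y + \<zeta>\<^sup>2 *s w)" using \<phi>(2)[OF \<zeta>] rz by linarith
      moreover have "z + \<zeta> *s Y + \<zeta>\<^sup>2 *s w \<in> U" "z + \<zeta> *s Y + \<zeta>\<^sup>2 *s w \<in> ball b \<rho>"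
        using \<phi>(1)[OF \<zeta>] subsetD[OF \<rho>'(3)] by simp_all
      ultimately show ?thesis using ext by simp
    qed
    have 2: "z + \<zeta> *s Y + \<zeta>\<^sup>2 *s w \<in> K" if \<zeta>: "cmod \<zeta> = \<delta> / 2" for \<zeta>
      using \<phi>[of \<zeta>] \<zeta> pos rz by (auto simp: K_def)
    show ?thesis by (intro exI[of _ Y] exI[of _ w] conjI allI impI Y 1 2)
  qed
  show ?thesis
    by (intro exI[of _ \<eta>] exI[of _ \<delta>] exI[of _ m] exI[of _ K] conjI ballI pos K1 K2 discs)
qed

section \<open>Connectedness of the complement\<close>

lemma norm_parallelogram: "(norm (p + q))\<^sup>2 + (norm (p - q))\<^sup>2 = 2 * (norm p)\<^sup>2 + 2 * (norm q)\<^sup>2"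
  for p q :: "'a::real_inner"
  by (simp add: power2_norm_eq_inner inner_simps)

text \<open>
  The mean value property of the squared norm for a quadratic disc, in an exact form that
  averages over four points: for \<open>\<xi> = \<delta>, - \<delta>, \<i> \<delta>, - \<i> \<delta>\<close> the parallelogram law removes
  all mixed terms.
\<close>

lemma norm_quadratic_disc_le:
  fixes z Y w :: "complex ^ 'n"
  assumes R: "\<And>\<xi>. cmod \<xi> = \<delta> \<Longrightarrow> norm (z + \<xi> *s Y + \<xi>\<^sup>2 *s w) \<le> R" and "0 \<le> \<delta>"
  shows "(norm z)\<^sup>2 + (\<delta> * norm Y)\<^sup>2 \<le> R\<^sup>2"
proof -
  define u where "u = complex_of_real \<delta> *s Y"
  define v where "v = (complex_of_real \<delta>)\<^sup>2 *s w"
  have sq: "(norm (z + \<xi> *s Y + \<xi>\<^sup>2 *s w))\<^sup>2 \<le> R\<^sup>2" if "cmod \<xi> = \<delta>" for \<xi>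
    using R[OF that] by (intro power_mono) auto
  have "(norm ((z + v) + u))\<^sup>2 \<le> R\<^sup>2"
    using sq[of "complex_of_real \<delta>"] \<open>0 \<le> \<delta>\<close> by (simp add: u_def v_def algebra_simps)
  moreover have "(norm ((z + v) - u))\<^sup>2 \<le> R\<^sup>2"
    using sq[of "- complex_of_real \<delta>"] \<open>0 \<le> \<delta>\<close> by (simp add: u_def v_def algebra_simps)
  moreover have "(norm ((z - v) + \<i> *s u))\<^sup>2 \<le> R\<^sup>2"
    using sq[of "\<i> * complex_of_real \<delta>"] \<open>0 \<le> \<delta>\<close>
    by (simp add: u_def v_def algebra_simps norm_mult power_mult_distrib vector_smult_assoc)
  moreover have "(norm ((z - v) - \<i> *s u))\<^sup>2 \<le> R\<^sup>2"
    using sq[of "- (\<i> * complex_of_real \<delta>)"] \<open>0 \<le> \<delta>\<close>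
    by (simp add: u_def v_def algebra_simps norm_mult power_mult_distrib vector_smult_assoc)
  ultimately have "(norm z)\<^sup>2 + (norm v)\<^sup>2 + (norm u)\<^sup>2 \<le> R\<^sup>2"
    using norm_parallelogram[of "z + v" u] norm_parallelogram[of "z - v" "\<i> *s u"] norm_parallelogram[of z v]
    by (simp add: norm_complex_smult)
  then have "(norm z)\<^sup>2 + (norm u)\<^sup>2 \<le> R\<^sup>2" using zero_le_power2[of "norm v"] by linarith
  moreover have "norm u = \<delta> * norm Y" using \<open>0 \<le> \<delta>\<close> by (simp add: u_def norm_complex_smult)
  ultimately show ?thesis by simp
qed

lemma continuous_on_quadratic_disc:
  fixes z Y w :: "complex ^ 'n"
  shows "continuous_on S (\<lambda>\<zeta>. z + \<zeta> *s Y + \<zeta>\<^sup>2 *s w)"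
  unfolding vector_scalar_mult_def by (intro continuous_intros)

text \<open>
  A bounded component \<open>C\<close> of the complement would have a point \<open>b\<close> of largest norm in its closure,
  necessarily on the boundary of \<open>D\<close>. For \<open>z\<close> in \<open>C\<close> close to \<open>b\<close> the exterior disc centred at \<open>z\<close>
  is connected and so stays in \<open>C\<close>. The mean of the squared norm over it exceeds that
  at \<open>z\<close> by a fixed amount, hence is larger than the maximum. So every component is unbounded, and
  there is only one such component because the real dimension is at least \<open>2\<close>.
\<close>

lemma connected_complement_closure:
  fixes D :: "(complex ^ 'n) set"
  assumes D: "open D" "compact (closure D)" and r: "C2_defining_function D r"
    and levi: "\<forall>b\<in>frontier D. \<exists>\<mu>>0. levi_eigenvalue r b \<mu>"
  shows "connected (- closure D)"
proof (rule ccontr)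
  assume "\<not> connected (- closure D)"
  moreover have "2 \<le> DIM(complex ^ 'n)"
  proof -
    have "1 \<le> CARD('n)" using zero_less_card_finite[where 'a = 'n] by linarith
    then show ?thesis by simp
  qed
  ultimately obtain C where C: "C \<in> components (- closure D)" "bounded C"
    using cobounded_has_bounded_component[of "- closure D"] compact_imp_bounded[OF D(2)] by auto
  have Cs: "C \<subseteq> - closure D" "C \<noteq> {}" using C(1) in_components_subset in_components_nonempty by blast+
  have "open C" using open_components[of "- closure D" C] C(1) by auto
  have "compact (closure C)" "closure C \<noteq> {}" using C(2) Cs by auto
  then obtain b where b: "b \<in> closure C" "\<And>x. x \<in> closure C \<Longrightarrow> norm x \<le> norm b"
    using continuous_attains_sup[of "closure C" norm] by (auto intro: continuous_intros)
  have max: "norm x \<le> norm b" if "x \<in> C" for x using b(2) that closure_subset by blast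
  have "b \<notin> C"
  proof
    assume "b \<in> C"
    then obtain e where e: "0 < e" "ball b e \<subseteq> C" using \<open>open C\<close> open_contains_ball by blast
    obtain v :: "complex ^ 'n" where v: "norm v = e / 2" using vector_choose_size[of "e / 2"] e by auto
    have "norm (b + v) \<le> norm b" "norm (b - v) \<le> norm b"
      using v e by (auto intro!: max subsetD[OF e(2)] simp: dist_norm)
    then have "(norm (b + v))\<^sup>2 \<le> (norm b)\<^sup>2" "(norm (b - v))\<^sup>2 \<le> (norm b)\<^sup>2"
      by (auto intro!: power_mono)
    then have "(norm v)\<^sup>2 \<le> 0" using norm_parallelogram[of b v] by linarith
    then show False using v e by simp
  qed
  then have "b \<in> frontier C" using b(1) \<open>open C\<close> by (simp add: frontier_def interior_open)
  then have b': "b \<in> frontier D"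
    using frontier_of_components_subset[OF C(1)] interior_mono[OF closure_subset[of D]]
    by (auto simp: frontier_complement frontier_def[of D] frontier_def[of "closure D"])
  from exterior_discs_at_boundary[OF D(1) r b' bspec[OF levi b'] zero_less_one]
  obtain \<eta> \<delta> m K where pos: "0 < \<eta>" "0 < \<delta>" "0 < m"
    and "compact K" "K \<subseteq> ball b 1 - closure D"
    and disc: "\<forall>z\<in>ball b \<eta> - closure D. \<exists>Y w. m \<le> norm Y \<and>
      (\<forall>\<zeta>. cmod \<zeta> \<le> \<delta> \<longrightarrow> z + \<zeta> *s Y + \<zeta>\<^sup>2 *s w \<in> ball b 1 - closure D) \<and>
      (\<forall>\<zeta>. cmod \<zeta> = \<delta> / 2 \<longrightarrow> z + \<zeta> *s Y + \<zeta>\<^sup>2 *s w \<in> K)"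
    by (elim exE conjE) (rule that; assumption)
  have "((\<lambda>z. (norm z)\<^sup>2) \<longlongrightarrow> (norm b)\<^sup>2) (nhds b)"
    by (intro tendsto_intros filterlim_ident)
  then have "\<forall>\<^sub>F z in nhds b. (norm b)\<^sup>2 - (\<delta> * m)\<^sup>2 < (norm z)\<^sup>2"
    by (rule order_tendstoD) (use pos in simp)
  then obtain e where e: "0 < e" "\<And>z. dist z b < e \<Longrightarrow> (norm b)\<^sup>2 - (\<delta> * m)\<^sup>2 < (norm z)\<^sup>2"
    unfolding eventually_nhds_metric by blast
  obtain z where z: "z \<in> C" "dist z b < min e \<eta>"
    using b(1) e(1) pos(1) unfolding closure_approachable by (meson min_less_iff_conj)
  then have "z \<in> ball b \<eta> - closure D" using Cs by (auto simp: dist_commute)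
  from bspec[OF disc this] obtain Y w where Y: "m \<le> norm Y" and
    \<phi>: "\<And>\<zeta>. cmod \<zeta> \<le> \<delta> \<Longrightarrow> z + \<zeta> *s Y + \<zeta>\<^sup>2 *s w \<notin> closure D" by blast
  define \<phi> where "\<phi> \<zeta> = z + \<zeta> *s Y + \<zeta>\<^sup>2 *s w" for \<zeta>
  have "\<phi> ` cball 0 \<delta> \<subseteq> C"
  proof (rule components_maximal[OF C(1)])
    show "connected (\<phi> ` cball 0 \<delta>)"
      unfolding \<phi>_def by (intro connected_continuous_image continuous_on_quadratic_disc) simp
    show "\<phi> ` cball 0 \<delta> \<subseteq> - closure D" using \<phi> by (auto simp: \<phi>_def)
    have "\<phi> 0 = z" by (simp add: \<phi>_def)
    then have "z \<in> \<phi> ` cball 0 \<delta>" using pos by (force intro: rev_image_eqI)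
    then show "C \<inter> \<phi> ` cball 0 \<delta> \<noteq> {}" using z(1) by blast
  qed
  then have "norm (z + \<zeta> *s Y + \<zeta>\<^sup>2 *s w) \<le> norm b" if "cmod \<zeta> = \<delta>" for \<zeta>
    using that by (intro max) (auto simp: \<phi>_def)
  then have "(norm z)\<^sup>2 + (\<delta> * norm Y)\<^sup>2 \<le> (norm b)\<^sup>2"
    using pos by (intro norm_quadratic_disc_le) auto
  moreover have "(\<delta> * m)\<^sup>2 \<le> (\<delta> * norm Y)\<^sup>2" using Y pos by (intro power_mono mult_left_mono) auto
  ultimately show False using e(2)[of z] z(2) by simp
qed

text \<open>
  Both \<open>G\<close> and \<open>- closure D\<close> are open and connected and they cover the space. By unicoherence
  their intersection is connected.
\<close>

lemma is_domain_diff_closure: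
  fixes D :: "(complex ^ 'n) set"
  assumes G: "is_domain G" "bounded G" and D: "open D" "compactly_contained D G"
    and r: "C2_defining_function D r"
    and levi: "\<forall>b\<in>frontier D. \<exists>\<mu>>0. levi_eigenvalue r b \<mu>"
  shows "is_domain (G - closure D)"
proof -
  have K: "compact (closure D)" "closure D \<subseteq> G" using D(2) by (auto simp: compactly_contained_def)
  have G': "open G" "connected G" "G \<noteq> {}" using G(1) by (auto simp: is_domain_def)
  have "connected (G \<inter> - closure D)"
    using K(2) G' connected_complement_closure[OF D(1) K(1) r levi]
    by (intro open_unicoherent_UNIV) auto
  then have "connected (G - closure D)" by (simp add: Diff_eq)
  moreover have "G - closure D \<noteq> {}"
  proof
    assume "G - closure D = {}"
    then have "G = closure D" using K(2) by blast
    then have "closed G" using closed_closure by metis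
    then have "G = UNIV" using G' clopen by blast
    then show False using G(2) not_bounded_UNIV by blast
  qed
  ultimately show ?thesis using open_Diff[OF G'(1) closed_closure] by (simp add: is_domain_def)
qed

section \<open>The collar of the removed set\<close>

text \<open>
  The exterior disc of radius \<open>\<delta>\<close> through \<open>z\<close> joins \<open>z\<close> within distance \<open>artanh (1 / 2)\<close> to a
  compact subset of the complement, on which the distance from \<open>v\<close> is bounded.
\<close>

lemma kobayashi_bounded_near_boundary_point:
  fixes D :: "(complex ^ 'n) set"
  assumes G: "open G" "closure D \<subseteq> G" and \<Omega>: "is_domain (G - closure D)"
    and D: "open D" and r: "C2_defining_function D r" and b: "b \<in> frontier D"
    and levi: "\<exists>\<mu>>0. levi_eigenvalue r b \<mu>" and v: "v \<in> G - closure D"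
  shows "\<exists>\<eta>>0. \<exists>M. \<forall>z\<in>ball b \<eta> - closure D. kobayashi (G - closure D) v z \<le> M"
proof -
  let ?\<Omega> = "G - closure D"
  note k = pseudodistance_kobayashi[OF \<Omega>]
  have "b \<in> G" using b G(2) by (auto simp: frontier_def)
  then obtain \<rho> where \<rho>: "0 < \<rho>" "ball b \<rho> \<subseteq> G" using G(1) open_contains_ball by blast
  from exterior_discs_at_boundary[OF D r b levi \<rho>(1)]
  obtain \<eta> \<delta> m K where pos: "0 < \<eta>" "0 < \<delta>" "0 < m" and K: "compact K" "K \<subseteq> ball b \<rho> - closure D"
    and disc: "\<forall>z\<in>ball b \<eta> - closure D. \<exists>Y w. m \<le> norm Y \<and>
      (\<forall>\<zeta>. cmod \<zeta> \<le> \<delta> \<longrightarrow> z + \<zeta> *s Y + \<zeta>\<^sup>2 *s w \<in> ball b \<rho> - closure D) \<and>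
      (\<forall>\<zeta>. cmod \<zeta> = \<delta> / 2 \<longrightarrow> z + \<zeta> *s Y + \<zeta>\<^sup>2 *s w \<in> K)"
    by (elim exE conjE) (rule that; assumption)
  have K\<Omega>: "K \<subseteq> ?\<Omega>" using K(2) \<rho>(2) by blast
  obtain B where B: "\<And>x. x \<in> K \<Longrightarrow> kobayashi ?\<Omega> v x \<le> B"
    using kobayashi_bounded_on_compact[OF \<Omega> v K(1) K\<Omega>] by blast
  have "kobayashi ?\<Omega> v z \<le> B + artanh (1 / 2)" if z: "z \<in> ball b \<eta> - closure D" for z
  proof -
    obtain Y w where
      \<phi>: "\<And>\<zeta>. cmod \<zeta> \<le> \<delta> \<Longrightarrow> z + \<zeta> *s Y + \<zeta>\<^sup>2 *s w \<in> ball b \<rho> - closure D"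
      "\<And>\<zeta>. cmod \<zeta> = \<delta> / 2 \<Longrightarrow> z + \<zeta> *s Y + \<zeta>\<^sup>2 *s w \<in> K"
      using bspec[OF disc z] by blast
    define \<phi> where "\<phi> \<zeta> = z + \<zeta> *s Y + \<zeta>\<^sup>2 *s w" for \<zeta>
    define \<alpha> where "\<alpha> = complex_of_real (\<delta> / 2)"
    have \<alpha>: "cmod \<alpha> = \<delta> / 2" using pos by (simp add: \<alpha>_def)
    have "kobayashi ?\<Omega> (\<phi> 0) (\<phi> \<alpha>) \<le> artanh (cmod \<alpha> / \<delta>)"
    proof (rule kobayashi_scaled_disc_le[OF \<Omega> pos(2)])
      show "(\<lambda>\<zeta>. \<phi> \<zeta> $ i) holomorphic_on ball 0 \<delta>" for i
        by (simp add: \<phi>_def) (intro holomorphic_intros)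
      show "\<phi> \<zeta> \<in> ?\<Omega>" if "cmod \<zeta> < \<delta>" for \<zeta> using \<phi>(1)[of \<zeta>] that \<rho>(2) by (auto simp: \<phi>_def)
    qed (use \<alpha> pos in simp)
    moreover have "\<phi> 0 = z" by (simp add: \<phi>_def)
    ultimately have "kobayashi ?\<Omega> z (\<phi> \<alpha>) \<le> artanh (1 / 2)" using \<alpha> pos by simp
    moreover have "\<phi> \<alpha> \<in> K" using \<phi>(2)[OF \<alpha>] by (simp add: \<phi>_def)
    moreover have z\<Omega>: "z \<in> ?\<Omega>" using \<phi>(1)[of 0] pos \<rho>(2) by auto
    moreover have "\<phi> \<alpha> \<in> ?\<Omega>" using \<open>\<phi> \<alpha> \<in> K\<close> K\<Omega> by blast
    ultimately show ?thesis
      using pseudodistance_onD(4)[OF k v, of "\<phi> \<alpha>" z] pseudodistance_onD(3)[OF k, of z "\<phi> \<alpha>"]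
        B[of "\<phi> \<alpha>"] by simp
  qed
  then show ?thesis using pos by blast
qed

lemma kobayashi_bounded_collar:
  fixes D :: "(complex ^ 'n) set"
  assumes G: "open G" and \<Omega>: "is_domain (G - closure D)"
    and D: "open D" "compactly_contained D G" and r: "C2_defining_function D r"
    and levi: "\<forall>b\<in>frontier D. \<exists>\<mu>>0. levi_eigenvalue r b \<mu>" and v: "v \<in> G - closure D"
  shows "\<exists>W M. open W \<and> closure D \<subseteq> W \<and> (\<forall>z\<in>W \<inter> (G - closure D). kobayashi (G - closure D) v z \<le> M)"
proof -
  have K: "compact (closure D)" "closure D \<subseteq> G" using D(2) by (auto simp: compactly_contained_def)
  have "\<exists>\<eta>>0. \<exists>M. \<forall>z\<in>ball b \<eta> - closure D. kobayashi (G - closure D) v z \<le> M" if "b \<in> frontier D" for b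
    using kobayashi_bounded_near_boundary_point[OF G K(2) \<Omega> D(1) r that _ v] levi that by blast
  then obtain \<eta> M where \<eta>: "\<And>b. b \<in> frontier D \<Longrightarrow> 0 < \<eta> b"
    and M: "\<And>b z. b \<in> frontier D \<Longrightarrow> z \<in> ball b (\<eta> b) - closure D \<Longrightarrow> kobayashi (G - closure D) v z \<le> M b"
    by metis
  have "compact (frontier D)"
    using K(1) compact_eq_bounded_closed bounded_subset[of "closure D" "frontier D"] by (auto simp: frontier_def)
  moreover have "frontier D \<subseteq> (\<Union>b\<in>frontier D. ball b (\<eta> b))" using \<eta> by force
  ultimately obtain F where F: "F \<subseteq> frontier D" "finite F" "frontier D \<subseteq> (\<Union>b\<in>F. ball b (\<eta> b))"
    using compactE_image[of "frontier D" "frontier D" "\<lambda>b. ball b (\<eta> b)"] by auto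
  define W where "W = D \<union> (\<Union>b\<in>F. ball b (\<eta> b))"
  have "open W" using D(1) by (auto simp: W_def)
  moreover have "closure D \<subseteq> W" using F(3) by (auto simp: W_def closure_Un_frontier)
  moreover have "kobayashi (G - closure D) v z \<le> (\<Sum>b\<in>F. \<bar>M b\<bar>)" if z: "z \<in> W \<inter> (G - closure D)" for z
  proof -
    have "z \<notin> D" using z closure_subset by blast
    then obtain b where b: "b \<in> F" "z \<in> ball b (\<eta> b)" using z by (auto simp: W_def)
    then have "kobayashi (G - closure D) v z \<le> M b" using M F(1) z by blast
    also have "\<dots> \<le> \<bar>M b\<bar>" by simp
    also have "\<dots> \<le> (\<Sum>b\<in>F. \<bar>M b\<bar>)" using b(1) F(2) by (intro member_le_sum) auto
    finally show ?thesis .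
  qed
  ultimately show ?thesis by blast
qed

section \<open>Additive equivalence and Gromov hyperbolicity\<close>

text \<open>
  Each Gromov product consists of three distances, so an error \<open>C\<close> in the distance changes the
  defect by at most \<open>6 * C\<close>.
\<close>

lemma gromov_hyperbolic_if_additively_close:
  assumes hyp: "gromov_hyperbolic X d" and "Y \<subseteq> X"
    and le: "\<And>x y. x \<in> Y \<Longrightarrow> y \<in> Y \<Longrightarrow> \<bar>d' x y - d x y\<bar> \<le> C"
  shows "gromov_hyperbolic Y d'"
proof -
  obtain B where B: "\<And>p q x w. p \<in> X \<Longrightarrow> q \<in> X \<Longrightarrow> x \<in> X \<Longrightarrow> w \<in> X \<Longrightarrow> gromov_defect d p q x w \<le> B"
    using hyp unfolding gromov_hyperbolic_def bdd_above_def by blast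
  have product: "\<bar>gromov_product d' x y z - gromov_product d x y z\<bar> \<le> 3 * C"
    if "x \<in> Y" "y \<in> Y" "z \<in> Y" for x y z
    using le[of x z] le[of z y] le[of x y] that unfolding gromov_product_def by linarith
  have "gromov_defect d' p q x w \<le> B + 6 * C" if Y: "p \<in> Y" "q \<in> Y" "x \<in> Y" "w \<in> Y" for p q x w
    using B[of p q x w] product[of p x w] product[of x q w] product[of p q w] Y \<open>Y \<subseteq> X\<close>
    unfolding gromov_defect_def by (simp add: subset_iff)
  then show ?thesis unfolding gromov_hyperbolic_def by (intro bdd_aboveI[of _ "B + 6 * C"]) blast
qed

theorem proposition5:
  fixes G D :: "(complex ^ 'n) set" and r :: "complex ^ 'n \<Rightarrow> real"
  assumes "CARD('n) \<ge> 2"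
    and "is_domain G" and "bounded G"
    and "is_domain D" and "compactly_contained D G"
    and "C2_defining_function D r"
    and "\<forall>b\<in>frontier D. \<exists>\<mu>>0. levi_eigenvalue r b \<mu>"
  shows "is_domain (G - closure D)
    \<and> quasi_isometrically_equivalent (G - closure D) (kobayashi (G - closure D)) (kobayashi G)
    \<and> (gromov_k_hyperbolic G \<longrightarrow> gromov_k_hyperbolic (G - closure D))"
proof -
  let ?\<Omega> = "G - closure D"
  have D: "open D" "D \<noteq> {}" and G: "open G" using assms(2,4) by (auto simp: is_domain_def)
  have K: "compact (closure D)" "closure D \<subseteq> G" using assms(5) by (auto simp: compactly_contained_def)
  obtain o' where o: "o' \<in> closure D" using D(2) closure_subset by blast
  have \<Omega>: "is_domain ?\<Omega>" by (rule is_domain_diff_closure[OF assms(2,3) D(1) assms(5-7)])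
  then obtain v where v: "v \<in> ?\<Omega>" by (auto simp: is_domain_def)
  obtain W M where "open W" "closure D \<subseteq> W" "\<And>z. z \<in> W \<inter> ?\<Omega> \<Longrightarrow> kobayashi ?\<Omega> v z \<le> M"
    using kobayashi_bounded_collar[OF G \<Omega> D(1) assms(5-7) v] by blast
  from kobayashi_complement_le[OF assms(2,3) \<Omega> K o this(1,2) v this(3)]
  obtain C where C: "0 \<le> C"
    and upper: "\<And>x y. x \<in> ?\<Omega> \<Longrightarrow> y \<in> ?\<Omega> \<Longrightarrow> kobayashi ?\<Omega> x y \<le> kobayashi G x y + C" by blast
  have lower: "kobayashi G x y \<le> kobayashi ?\<Omega> x y" if "x \<in> ?\<Omega>" "y \<in> ?\<Omega>" for x y
    using that by (intro kobayashi_antimono[OF \<Omega> assms(2)]) auto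
  have "quasi_isometrically_equivalent ?\<Omega> (kobayashi ?\<Omega>) (kobayashi G)"
    unfolding quasi_isometrically_equivalent_def
  proof (intro exI conjI ballI)
    fix x y assume xy: "x \<in> ?\<Omega>" "y \<in> ?\<Omega>"
    show "inverse 1 * kobayashi ?\<Omega> x y - (C + 1) \<le> kobayashi G x y" using upper[OF xy] by simp
    show "kobayashi G x y \<le> 1 * kobayashi ?\<Omega> x y + (C + 1)" using lower[OF xy] C by simp
  qed (use C in auto)
  moreover have "gromov_k_hyperbolic ?\<Omega>" if "gromov_k_hyperbolic G"
    using that unfolding gromov_k_hyperbolic_def
  proof (rule gromov_hyperbolic_if_additively_close)
    show "\<bar>kobayashi ?\<Omega> x y - kobayashi G x y\<bar> \<le> C" if "x \<in> ?\<Omega>" "y \<in> ?\<Omega>" for x y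
      using lower[OF that] upper[OF that] by linarith
  qed blast
  ultimately show ?thesis using \<Omega> by blast
qed

end
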